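(* Let $l,m,n,N,r$ be positive integers such that $l$ is even, $m$ is even, and $ln\le N$. For $1\le s\le r$ let $H(s)$ be a map $[ln]^{m-1}\times[N]\to F$, $(i_1,\dots,i_m)\mapsto H(s)(i_1,\dots,i_m)$ (an $m$-dimensional tensor of size $ln\times\cdots\times ln\times N$), and let $A=(A(I^{(1)},\dots,I^{(r)}))_{I^{(1)},\dots,I^{(r)}\in\binom{[N]}{l}}$ be an $r$-dimensional $l$-block array of size $N$. Define the $(m-1)r$-dimensional $l$-block array $Q$ of size $ln$ by \[ Q(I^{(1,1)},\dots,I^{(1,m-1)},\dots,I^{(r,1)},\dots,I^{(r,m-1)}) =\sum_{K^{(1)},\dots,K^{(r)}\in\binom{[N]}{l}} A(K^{(1)},\dots,K^{(r)})\prod_{s=1}^{r}{\det}^{[m]}\bigl(H(s)_{I^{(s,1)},\dots,I^{(s,m-1)},K^{(s)}}\bigr) \] for $I^{(s,k)}\in\binom{[ln]}{l}$. Then \[ \sum_{P^{(1)},\dots,P^{(r)}\in\binom{[N]}{ln}}\mathrm{Pf}^{[l,r]}\bigl(A_{P^{(1)},\dots,P^{(r)}}\bigr)\prod_{s=1}^{r}{\det}^{[m]}\bigl(H(s)_{[ln],\dots,[ln],P^{(s)}}\bigr)=\mathrm{Pf}^{[l,(m-1)r]}(Q). \]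
   Context: $F$ is a field of characteristic $0$ and $[n]=\{1,\dots,n\}$. $\binom{S}{r}$ is the set of $r$-element subsets of a finite set $S$; a subset of $[M]$ is identified with the increasing sequence of its elements. For $m$ even, an $m$-dimensional tensor of size $n$ is a map $A:[n]^m\to F$, and its hyperdeterminant is ${\det}^{[m]}A=\sum_{\sigma_1,\dots,\sigma_{m-1}\in\mathfrak S_n}\mathrm{sgn}(\sigma_1\cdots\sigma_{m-1})\prod_{i=1}^nA(i,\sigma_1(i),\dots,\sigma_{m-1}(i))$ (equivalently $\frac1{n!}\sum_{\sigma_1,\dots,\sigma_m\in\mathfrak S_n}\mathrm{sgn}(\sigma_1\cdots\sigma_m)\prod_iA(\sigma_1(i),\dots,\sigma_m(i))$). For a tensor $H$ and sequences $J_1,\dots,J_m$ of common length $t$ with entries in the respective index ranges, $H_{J_1,\dots,J_m}$ is the $m$-dimensional tensor of size $t$ whose $(a_1,\dots,a_m)$ entry is $H(j_1(a_1),\dots,j_m(a_m))$, where $J_k=(j_k(1),\dots,j_k(t))$. An $m$-dimensional $l$-block array of size $M$ is a family $B=(B(I^{(1)},\dots,I^{(m)}))_{I^{(1)},\dots,I^{(m)}\in\binom{[M]}{l}}$ of elements of $F$. Let $\binom{[ln]}{l,\dots,l}$ be the set of permutations $\sigma\in\mathfrak S_{ln}$ (in one-line notation) such that $\sigma((k-1)l+1)<\cdots<\sigma(kl)$ for $1\le k\le n$; write $\sigma=(\sigma_1,\dots,\sigma_n)$ with $\sigma_k=(\sigma((k-1)l+1),\dots,\sigma(kl))\in\binom{[ln]}{l}$.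 For an $m$-dimensional $l$-block array $B$ of size $ln$, the hyperpfaffian is \[\mathrm{Pf}^{[l,m]}(B)=\frac1{n!}\sum_{\sigma^{(1)},\dots,\sigma^{(m)}\in\binom{[ln]}{l,\dots,l}}\mathrm{sgn}(\sigma^{(1)})\cdots\mathrm{sgn}(\sigma^{(m)})\prod_{k=1}^nB(\sigma^{(1)}_k,\dots,\sigma^{(m)}_k).\] For an $m$-dimensional $l$-block array $B$ of size $M$ and $P^{(1)},\dots,P^{(m)}\in\binom{[M]}{lt}$, $B_{P^{(1)},\dots,P^{(m)}}$ is the $m$-dimensional $l$-block array of size $lt$ given by $B_{P^{(1)},\dots,P^{(m)}}(I^{(1)},\dots,I^{(m)})=B(P^{(1)}(I^{(1)}),\dots,P^{(m)}(I^{(m)}))$, where for $P=(p_1<\dots<p_{lt})$ and $I=\{i_1<\dots<i_l\}\subseteq[lt]$ one sets $P(I)=\{p_{i_1},\dots,p_{i_l}\}$. *)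

theory Defs
  imports
    Complex_Main
    "HOL-Combinatorics.Permutations"
    "HOL-Library.NList"
    "HOL-Library.Ramsey"
begin

text \<open>
  Index ranges are 1-based, \<open>[n] = {1..n}\<close>. An \<open>m\<close>-dimensional tensor is a function on index
  lists and an \<open>m\<close>-dimensional block array a function on lists of sets; only the values at lists
  of length \<open>m\<close> with entries in the index range (\<^term>\<open>nlists\<close>) matter, where the index range is
  \<open>{1..n}\<close> for tensors and \<^term>\<open>nsets {1..M} l\<close> for \<open>l\<close>-block arrays of size \<open>M\<close>.
\<close>

definition hyperdet :: "nat \<Rightarrow> nat \<Rightarrow> (nat list \<Rightarrow> 'a) \<Rightarrow> 'a::comm_ring_1" where
  "hyperdet m n A =
     (\<Sum>\<sigma>s \<in> nlists (m - 1) {\<sigma>. \<sigma> permutes {1..n}}.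
        of_int (sign (foldr (\<circ>) \<sigma>s id)) * (\<Prod>i = 1..n. A (i # map (\<lambda>\<sigma>. \<sigma> i) \<sigma>s)))"

text \<open>The sequences are given as lists, whose \<open>a\<close>-th entry in the 1-based count is \<open>J ! (a - 1)\<close>.\<close>

definition subtensor :: "(nat list \<Rightarrow> 'a) \<Rightarrow> nat list list \<Rightarrow> nat list \<Rightarrow> 'a" where
  "subtensor H Js = (\<lambda>as. H (map2 (\<lambda>J a. J ! (a - 1)) Js as))"

text \<open>The \<open>k\<close>-th of the consecutive intervals of length \<open>l\<close> in \<open>{1..l * n}\<close>.\<close>

definition interval :: "nat \<Rightarrow> nat \<Rightarrow> nat set" where
  "interval l k = {(k - 1) * l + 1..k * l}"

definition block_perms :: "nat \<Rightarrow> nat \<Rightarrow> (nat \<Rightarrow> nat) set" where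
  "block_perms l n =
     {\<sigma>. \<sigma> permutes {1..l * n} \<and> (\<forall>k \<in> {1..n}. strict_mono_on (interval l k) \<sigma>)}"

text \<open>
  \<open>\<sigma>\<^sub>k\<close> is the image of the \<open>k\<close>-th interval, since increasing sequences are identified with
  their sets of entries. The first two arguments of \<open>hyperpf\<close> are the block length and the
  dimension; the array has size \<open>l * n\<close>.
\<close>

definition hyperpf :: "nat \<Rightarrow> nat \<Rightarrow> nat \<Rightarrow> (nat set list \<Rightarrow> 'a) \<Rightarrow> 'a::field_char_0" where
  "hyperpf l m n B =
     1 / fact n *
     (\<Sum>\<sigma>s \<in> nlists m (block_perms l n).
        of_int (prod_list (map sign \<sigma>s)) *
        (\<Prod>k = 1..n. B (map (\<lambda>\<sigma>. \<sigma> ` interval l k) \<sigma>s)))"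

definition subset_at :: "nat set \<Rightarrow> nat set \<Rightarrow> nat set" where
  "subset_at P I = (\<lambda>i. sorted_list_of_set P ! (i - 1)) ` I"

definition subarray :: "(nat set list \<Rightarrow> 'a) \<Rightarrow> nat set list \<Rightarrow> nat set list \<Rightarrow> 'a" where
  "subarray B Ps = (\<lambda>Is. B (map2 subset_at Ps Is))"

text \<open>
  For the list \<open>I\<^sup>(\<^sup>1\<^sup>,\<^sup>1\<^sup>), \<dots>, I\<^sup>(\<^sup>1\<^sup>,\<^sup>d\<^sup>), \<dots>, I\<^sup>(\<^sup>r\<^sup>,\<^sup>1\<^sup>), \<dots>, I\<^sup>(\<^sup>r\<^sup>,\<^sup>d\<^sup>)\<close> this is the group
  \<open>I\<^sup>(\<^sup>s\<^sup>,\<^sup>1\<^sup>), \<dots>, I\<^sup>(\<^sup>s\<^sup>,\<^sup>d\<^sup>)\<close>.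
\<close>

definition index_group :: "nat \<Rightarrow> nat \<Rightarrow> 'b list \<Rightarrow> 'b list" where
  "index_group d s xs = take d (drop ((s - 1) * d) xs)"

end

theory Submission
  imports Defs
begin

text \<open>
  For a word \<open>w\<close> of length \<open>L = l n\<close> let \<open>T\<^sub>s(w)\<close> be the signed sum over \<open>m - 1\<close> permutations
  \<open>\<pi>\<^sub>1, \<dots>, \<pi>\<^sub>m\<^sub>-\<^sub>1\<close> of \<open>[L]\<close> of \<open>\<Prod>\<^sub>i H(s)(\<pi>\<^sub>1(i), \<dots>, \<pi>\<^sub>m\<^sub>-\<^sub>1(i), w(i))\<close>. Since \<open>m\<close> is even, the
  hyperdeterminant with column set \<open>P\<close> is \<open>T\<^sub>s\<close> of the increasing enumeration of \<open>P\<close>, and \<open>T\<^sub>s\<close> is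
  alternating in the letters of \<open>w\<close>. Every permutation of \<open>[L]\<close> factors uniquely into an element of
  \<open>binom([ln], l,\<dots>,l)\<close> and permutations of the \<open>n\<close> blocks, so expanding the \<open>l \<times> \<dots> \<times> l\<close>
  hyperdeterminants in \<open>Pf(Q)\<close> (a Laplace expansion) turns the signed sum over the
  \<open>\<sigma>\<^sup>(\<^sup>s\<^sup>,\<^sup>k\<^sup>)\<close> into \<open>T\<^sub>s\<close> of the concatenation of \<open>K\<^sub>1\<^sup>(\<^sup>s\<^sup>), \<dots>, K\<^sub>n\<^sup>(\<^sup>s\<^sup>)\<close>. This vanishes unless these
  sets are disjoint, and the disjoint families correspond bijectively to pairs of an \<open>L\<close>-subset
  \<open>P\<close> and some \<open>\<tau>\<close> in \<open>binom([ln], l,\<dots>,l)\<close>, whose sign is the factor that \<open>T\<^sub>s\<close> picks up.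
\<close>

declare One_nat_def [simp del]

text \<open>As a rewrite rule this loops together with \<open>nlists_def\<close>.\<close>

declare nlistsE_set [simp del]

section \<open>Sums over fixed-length lists\<close>

lemma finite_nlists: "finite X \<Longrightarrow> finite (nlists n X)"
  by (induction n) (simp_all add: nlists_Suc)

lemma sum_nlists_Suc:
  assumes "finite X"
  shows "(\<Sum>xs\<in>nlists (Suc n) X. F xs) = (\<Sum>x\<in>X. \<Sum>xs\<in>nlists n X. F (x # xs))"
proof -
  have "(\<Sum>x\<in>X. \<Sum>xs\<in>nlists n X. F (x # xs)) = (\<Sum>(x, xs)\<in>X \<times> nlists n X. F (x # xs))"
    by (simp add: sum.cartesian_product)
  also have "\<dots> = (\<Sum>xs\<in>nlists (Suc n) X. F xs)"
    by (rule sum.reindex_bij_witness[where j = "\<lambda>(x, xs). x # xs" and i = "\<lambda>xs. (hd xs, tl xs)"])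
       (auto simp: in_nlists_Suc_iff)
  finally show ?thesis by simp
qed

lemma sum_nlists_reindex:
  assumes "bij_betw \<phi> X Y" and "finite X"
  shows "(\<Sum>ys\<in>nlists n Y. F ys) = (\<Sum>xs\<in>nlists n X. F (map \<phi> xs))"
proof (induction n arbitrary: F)
  case (Suc n)
  have "finite Y" using assms bij_betw_finite by blast
  then have "(\<Sum>ys\<in>nlists (Suc n) Y. F ys) = (\<Sum>y\<in>Y. \<Sum>xs\<in>nlists n X. F (y # map \<phi> xs))"
    by (simp add: sum_nlists_Suc Suc.IH)
  also have "\<dots> = (\<Sum>x\<in>X. \<Sum>xs\<in>nlists n X. F (\<phi> x # map \<phi> xs))"
    using assms(1) by (rule sum.reindex_bij_betw[symmetric])
  finally show ?case by (simp add: sum_nlists_Suc assms)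
qed simp

text \<open>Two lists of equal length are one list of pairs. This merges the
  \<open>\<sigma>\<close>s with the block permutations in \<open>laplace_expansion\<close> and
  separates the sets \<open>P\<close> from the \<open>\<tau>\<close>s in the theorem, so that a
  bijection between single entries can be used through \<open>sum_nlists_reindex\<close>.\<close>

lemma sum_nlists_Times:
  assumes "finite X" "finite Y"
  shows "(\<Sum>xs\<in>nlists n X. \<Sum>ys\<in>nlists n Y. F xs ys)
    = (\<Sum>zs\<in>nlists n (X \<times> Y). F (map fst zs) (map snd zs))"
proof (induction n arbitrary: F)
  case (Suc n)
  have "(\<Sum>xs\<in>nlists (Suc n) X. \<Sum>ys\<in>nlists (Suc n) Y. F xs ys)
    = (\<Sum>x\<in>X. \<Sum>xs\<in>nlists n X. \<Sum>y\<in>Y. \<Sum>ys\<in>nlists n Y. F (x # xs) (y # ys))"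
    by (simp add: sum_nlists_Suc assms)
  also have "\<dots> = (\<Sum>x\<in>X. \<Sum>y\<in>Y. \<Sum>xs\<in>nlists n X. \<Sum>ys\<in>nlists n Y. F (x # xs) (y # ys))"
    by (intro sum.cong refl sum.swap)
  also have "\<dots> = (\<Sum>x\<in>X. \<Sum>y\<in>Y. \<Sum>zs\<in>nlists n (X \<times> Y). F (x # map fst zs) (y # map snd zs))"
    by (simp add: Suc.IH)
  also have "\<dots> = (\<Sum>(x, y)\<in>X \<times> Y. \<Sum>zs\<in>nlists n (X \<times> Y). F (x # map fst zs) (y # map snd zs))"
    by (rule sum.cartesian_product)
  finally show ?case
    by (simp add: sum_nlists_Suc assms case_prod_unfold)
qed simp

lemma sum_nlists_append:
  assumes "finite X"
  shows "(\<Sum>xs\<in>nlists (p + q) X. F xs) = (\<Sum>xs\<in>nlists p X. \<Sum>ys\<in>nlists q X. F (xs @ ys))"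
  by (induction p arbitrary: F) (simp_all add: sum_nlists_Suc assms)

text \<open>A list of length \<open>d * r\<close> consists of \<open>r\<close> independent groups,
  so distributivity applies; the induction splits off the last group. In the theorem this decouples
  the tensors \<open>H s\<close> from one another.\<close>

lemma sum_nlists_index_group:
  fixes f :: "nat \<Rightarrow> 'b list \<Rightarrow> 'a::comm_semiring_1"
  assumes "finite X"
  shows "(\<Sum>xs\<in>nlists (d * r) X. \<Prod>s = 1..r. f s (index_group d s xs))
    = (\<Prod>s = 1..r. \<Sum>ys\<in>nlists d X. f s ys)"
proof (induction r)
  case (Suc r)
  \<comment> \<open>Group \<open>s = t + 1\<close> ends at position
    \<open>d * t + d \<le> d * r\<close>, hence inside \<open>xs\<close>.\<close>
  have 1: "index_group d s (xs @ ys) = index_group d s xs"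
    if "xs \<in> nlists (d * r) X" "s \<in> {1..r}" for s and xs ys :: "'b list"
  proof -
    from that obtain t where "s = Suc t" "t < r" by (cases s) auto
    then have "d * t + d \<le> d * r"
      by (metis Suc_leI mult.commute mult_Suc_right add.commute mult_le_mono2)
    with that \<open>s = Suc t\<close> show ?thesis
      by (simp add: index_group_def mult.commute)
  qed
  have 2: "index_group d (Suc r) (xs @ ys) = ys"
    if "xs \<in> nlists (d * r) X" "ys \<in> nlists d X" for xs ys :: "'b list"
    using that by (simp add: index_group_def mult.commute)
  have "(\<Sum>xs\<in>nlists (d * Suc r) X. \<Prod>s = 1..Suc r. f s (index_group d s xs))
    = (\<Sum>xs\<in>nlists (d * r) X. \<Sum>ys\<in>nlists d X. \<Prod>s = 1..Suc r. f s (index_group d s (xs @ ys)))"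
    using sum_nlists_append[OF assms, where p = "d * r" and q = d] by (simp add: add.commute)
  also have "\<dots> = (\<Sum>xs\<in>nlists (d * r) X. \<Sum>ys\<in>nlists d X.
      (\<Prod>s = 1..r. f s (index_group d s xs)) * f (Suc r) ys)"
    by (intro sum.cong refl) (simp add: 1 2)
  also have "\<dots> = (\<Prod>s = 1..Suc r. \<Sum>ys\<in>nlists d X. f s ys)"
    using Suc.IH by (simp add: sum_product[symmetric])
  finally show ?case .
qed simp

lemma prod_list_index_group:
  fixes f :: "'b \<Rightarrow> 'a::comm_monoid_mult"
  assumes "length xs = d * r"
  shows "prod_list (map f xs) = (\<Prod>s = 1..r. prod_list (map f (index_group d s xs)))"
  using assms
proof (induction r arbitrary: xs)
  case (Suc r)
  have 1: "index_group d s xs = index_group d s (take (d * r) xs)" if "s \<in> {1..r}" for s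
  proof -
    from that obtain t where "s = Suc t" "t < r" by (cases s) auto
    then have "d * t + d \<le> d * r"
      by (metis Suc_leI mult.commute mult_Suc_right add.commute mult_le_mono2)
    then have "min d (d * r - d * t) = d" by simp
    with Suc.prems \<open>s = Suc t\<close> show ?thesis
      by (simp add: index_group_def mult.commute drop_take)
  qed
  have 2: "index_group d (Suc r) xs = drop (d * r) xs"
    using Suc.prems by (simp add: index_group_def mult.commute)
  have "prod_list (map f xs) = prod_list (map f (take (d * r) xs)) * prod_list (map f (drop (d * r) xs))"
    by (metis append_take_drop_id map_append prod_list.append)
  also have "prod_list (map f (take (d * r) xs)) = (\<Prod>s = 1..r. prod_list (map f (index_group d s xs)))"
    using Suc.prems by (subst Suc.IH) (simp_all add: 1)
  finally show ?case by (simp add: 2)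
qed simp

lemma index_group_map: "index_group d s (map f xs) = map f (index_group d s xs)"
  by (simp add: index_group_def take_map drop_map)

text \<open>Multiplying out chooses a list of length \<open>r\<close> for every \<open>k\<close>.
  The choice is recorded transposed, as \<open>r\<close> functions on \<open>S\<close>, because each
  of these functions later forms one family of blocks.\<close>

lemma prod_sum_nlists:
  fixes g :: "'k \<Rightarrow> 'b list \<Rightarrow> 'a::comm_ring_1"
  assumes "finite S" "finite X"
  shows "(\<Prod>k\<in>S. \<Sum>xs\<in>nlists r X. g k xs)
    = (\<Sum>\<kappa>s\<in>nlists r (S \<rightarrow>\<^sub>E X). \<Prod>k\<in>S. g k (map (\<lambda>\<kappa>. \<kappa> k) \<kappa>s))"
proof (induction r arbitrary: g)
  case (Suc r)
  have "(\<Prod>k\<in>S. \<Sum>xs\<in>nlists (Suc r) X. g k xs) = (\<Prod>k\<in>S. \<Sum>x\<in>X. \<Sum>xs\<in>nlists r X. g k (x # xs))"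
    by (simp add: sum_nlists_Suc assms)
  also have "\<dots> = (\<Sum>\<kappa>\<in>S \<rightarrow>\<^sub>E X. \<Prod>k\<in>S. \<Sum>xs\<in>nlists r X. g k (\<kappa> k # xs))"
    using assms by (intro prod_sum_PiE)
  also have "\<dots> = (\<Sum>\<kappa>\<in>S \<rightarrow>\<^sub>E X. \<Sum>\<kappa>s\<in>nlists r (S \<rightarrow>\<^sub>E X). \<Prod>k\<in>S. g k (\<kappa> k # map (\<lambda>\<kappa>. \<kappa> k) \<kappa>s))"
    by (simp add: Suc.IH)
  finally show ?case
    using assms by (simp add: sum_nlists_Suc finite_PiE)
qed simp

section \<open>Blocks of consecutive indices\<close>

lemma block_index_unique:
  fixes k k' a a' l :: nat
  assumes "(k - 1) * l + a = (k' - 1) * l + a'" "a \<in> {1..l}" "a' \<in> {1..l}" "k \<ge> 1" "k' \<ge> 1"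
  shows "k = k'" "a = a'"
proof -
  \<comment> \<open>Passing from \<open>a\<close> to \<open>a - 1\<close> turns the offsets into
    remainders below \<open>l\<close>, so that division by \<open>l\<close> recovers
    \<open>k - 1\<close>.\<close>
  have eq: "(k - 1) * l + (a - 1) = (k' - 1) * l + (a' - 1)"
    using assms by auto
  have "a - 1 < l" "a' - 1 < l" using assms by auto
  then have "((k - 1) * l + (a - 1)) div l = k - 1" "((k' - 1) * l + (a' - 1)) div l = k' - 1"
    by (simp_all del: Nat.add_diff_assoc Nat.add_diff_assoc2)
  then have "k - 1 = k' - 1" using eq by metis
  then show "k = k'" using assms by simp
  then show "a = a'" using assms by simp
qed

lemma block_index_exists:
  fixes i l n :: nat
  assumes "i \<in> {1..l * n}"
  obtains k a where "k \<in> {1..n}" "a \<in> {1..l}" "i = (k - 1) * l + a"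
proof
  have "l > 0" using assms by (cases l) auto
  have "(i - 1) div l < n"
    using assms by (intro less_mult_imp_div_less) (auto simp: mult.commute)
  then show "(i - 1) div l + 1 \<in> {1..n}" by auto
  show "(i - 1) mod l + 1 \<in> {1..l}"
    using mod_less_divisor[OF \<open>l > 0\<close>, of "i - 1"] by auto
  show "i = (((i - 1) div l + 1) - 1) * l + ((i - 1) mod l + 1)"
    using assms div_mult_mod_eq[of "i - 1" l] by auto
qed

lemma block_index_in_range:
  fixes k a l n :: nat
  assumes "k \<in> {1..n}" "a \<in> {1..l}"
  shows "(k - 1) * l + a \<in> {1..l * n}"
proof -
  have "(k - 1) * l + l = k * l" using assms by (cases k) auto
  also have "\<dots> \<le> n * l" using assms by (intro mult_right_mono) auto
  finally show ?thesis using assms by (auto simp: mult.commute)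
qed

lemma block_index_bij:
  "bij_betw (\<lambda>(k, a). (k - 1) * l + a) ({1..n} \<times> {1..l}) {1..l * n :: nat}"
  unfolding bij_betw_def
proof
  show "inj_on (\<lambda>(k, a). (k - 1) * l + a) ({1..n} \<times> {1..l})"
  proof (rule inj_onI, clarify)
    fix k a k' a' :: nat
    assume "k \<in> {1..n}" "a \<in> {1..l}" "k' \<in> {1..n}" "a' \<in> {1..l}"
      and "(k - 1) * l + a = (k' - 1) * l + a'"
    then show "k = k' \<and> a = a'" using block_index_unique[of k l a k' a'] by auto
  qed
  have "(\<lambda>(k, a). (k - 1) * l + a) ` ({1..n} \<times> {1..l}) \<subseteq> {1..l * n}"
    using block_index_in_range by (auto simp del: atLeastAtMost_iff)
  moreover have "{1..l * n} \<subseteq> (\<lambda>(k, a). (k - 1) * l + a) ` ({1..n} \<times> {1..l})"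
  proof
    fix i assume "i \<in> {1..l * n}"
    then obtain k a where "k \<in> {1..n}" "a \<in> {1..l}" "i = (k - 1) * l + a"
      by (rule block_index_exists)
    then show "i \<in> (\<lambda>(k, a). (k - 1) * l + a) ` ({1..n} \<times> {1..l})"
      by (intro image_eqI[where x = "(k, a)"]) auto
  qed
  ultimately show "(\<lambda>(k, a). (k - 1) * l + a) ` ({1..n} \<times> {1..l}) = {1..l * n}"
    by (rule subset_antisym)
qed

lemma prod_blocks:
  fixes l n :: nat
  shows "(\<Prod>i = 1..l * n. F i) = (\<Prod>k = 1..n. \<Prod>a = 1..l. F ((k - 1) * l + a))"
  using prod.reindex_bij_betw[OF block_index_bij[of l n], of F]
  by (simp add: prod.cartesian_product case_prod_unfold)

lemma interval_altdef:
  assumes "k \<ge> 1"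
  shows "interval l k = (\<lambda>a. (k - 1) * l + a) ` {1..l}"
proof -
  have "k * l = (k - 1) * l + l" using assms by (cases k) auto
  then show ?thesis
    by (simp add: interval_def image_add_atLeastAtMost)
qed

lemma interval_iff:
  "k \<ge> 1 \<Longrightarrow> i \<in> interval l k \<longleftrightarrow> (\<exists>a\<in>{1..l}. i = (k - 1) * l + a)"
  by (simp only: interval_altdef image_iff)

lemma interval_subset: "k \<in> {1..n} \<Longrightarrow> interval l k \<subseteq> {1..l * n}"
proof
  fix i assume k: "k \<in> {1..n}" and "i \<in> interval l k"
  then obtain a where "a \<in> {1..l}" "i = (k - 1) * l + a"
    by (auto simp: interval_iff)
  with k show "i \<in> {1..l * n}" using block_index_in_range by simp
qed

lemma card_interval: "k \<ge> 1 \<Longrightarrow> card (interval l k) = l"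
  by (simp add: interval_altdef card_image)

lemma finite_interval: "finite (interval l k)"
  by (simp add: interval_def)

lemma interval_disjoint:
  assumes "k \<ge> 1" "k' \<ge> 1" "k \<noteq> k'"
  shows "interval l k \<inter> interval l k' = {}"
proof -
  have "i \<notin> interval l k'" if i: "i \<in> interval l k" for i
  proof
    assume "i \<in> interval l k'"
    with assms obtain a' where a': "a' \<in> {1..l}" "i = (k' - 1) * l + a'"
      by (auto simp: interval_iff)
    from i assms obtain a where "a \<in> {1..l}" "i = (k - 1) * l + a"
      by (auto simp: interval_iff)
    with a' assms show False using block_index_unique(1)[of k l a k' a'] by simp
  qed
  then show ?thesis by blast
qed

lemma UN_interval: "(\<Union>k\<in>{1..n}. interval l k) = {1..l * n}"
proof
  show "(\<Union>k\<in>{1..n}. interval l k) \<subseteq> {1..l * n}"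
    using interval_subset by blast
  show "{1..l * n} \<subseteq> (\<Union>k\<in>{1..n}. interval l k)"
  proof
    fix i assume "i \<in> {1..l * n}"
    then obtain k a where "k \<in> {1..n}" "a \<in> {1..l}" "i = (k - 1) * l + a"
      by (rule block_index_exists)
    then show "i \<in> (\<Union>k\<in>{1..n}. interval l k)"
      by (intro UN_I[of k]) (simp_all add: interval_altdef)
  qed
qed

section \<open>Gluing maps and permutations block by block\<close>

definition blockwise :: "nat \<Rightarrow> nat \<Rightarrow> (nat \<Rightarrow> nat \<Rightarrow> nat) \<Rightarrow> nat \<Rightarrow> nat" where
  "blockwise l n g i =
     (if i \<in> {1..l * n} then g ((i - 1) div l + 1) ((i - 1) mod l + 1) else i)"

lemma blockwise_apply:
  assumes "k \<in> {1..n}" "a \<in> {1..l}"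
  shows "blockwise l n g ((k - 1) * l + a) = g k a"
proof -
  have eq: "(k - 1) * l + a - 1 = (a - 1) + (k - 1) * l" and "a - 1 < l"
    using assms by auto
  have "((k - 1) * l + a - 1) div l + 1 = k" "((k - 1) * l + a - 1) mod l + 1 = a"
    unfolding eq using assms \<open>a - 1 < l\<close>
    by (simp_all del: Nat.add_diff_assoc Nat.add_diff_assoc2)
  then show ?thesis
    using block_index_in_range[OF assms] by (simp add: blockwise_def del: atLeastAtMost_iff)
qed

lemma blockwise_outside: "i \<notin> {1..l * n} \<Longrightarrow> blockwise l n g i = i"
  by (auto simp: blockwise_def)

text \<open>If every \<open>\<rho> k\<close> permutes \<open>{1..l}\<close>, this is an element of
  the Young subgroup, the permutations of \<open>{1..l * n}\<close> that preserve each interval. The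
  identity outside \<open>{1..l * n}\<close>, built into \<open>blockwise\<close>, is what
  \<open>permutes\<close> asks for.\<close>

definition glue_perms :: "nat \<Rightarrow> nat \<Rightarrow> (nat \<Rightarrow> nat \<Rightarrow> nat) \<Rightarrow> nat \<Rightarrow> nat" where
  "glue_perms l n \<rho> = blockwise l n (\<lambda>k a. (k - 1) * l + \<rho> k a)"

lemma glue_perms_apply:
  "k \<in> {1..n} \<Longrightarrow> a \<in> {1..l} \<Longrightarrow> glue_perms l n \<rho> ((k - 1) * l + a) = (k - 1) * l + \<rho> k a"
  unfolding glue_perms_def by (rule blockwise_apply)

text \<open>Splits off the last block: its permutation is moved to
  \<open>{n * l + 1..n * l + l}\<close>, while the remaining glued map moves points of
  \<open>{1..l * n}\<close> only. The factorization serves to compute the sign by induction on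
  \<open>n\<close>.\<close>

lemma glue_perms_Suc:
  assumes "\<rho> (Suc n) permutes {1..l}"
  shows "glue_perms l (Suc n) \<rho> =
    glue_perms l n \<rho> \<circ> map_permutation {1..l} (\<lambda>a. n * l + a) (\<rho> (Suc n))"
proof
  define q where "q = map_permutation {1..l} (\<lambda>a. n * l + a) (\<rho> (Suc n))"
  have bij: "bij_betw (\<lambda>a. n * l + a) {1..l} {n * l + 1..n * l + l}"
    by (simp add: bij_betw_def image_add_atLeastAtMost)
  then have q: "q permutes {n * l + 1..n * l + l}"
    unfolding q_def using assms by (rule map_permutation_permutes)
  fix i
  consider "i \<in> {1..l * n}" | a where "a \<in> {1..l}" "i = n * l + a" | "i \<notin> {1..l * Suc n}"
  proof (cases "i \<in> {1..l * Suc n} \<and> i \<notin> {1..l * n}")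
    case True
    then have "i - n * l \<in> {1..l}" "i = n * l + (i - n * l)" by (auto simp: mult.commute)
    then show ?thesis using that by blast
  qed (use that in blast)
  then have "glue_perms l (Suc n) \<rho> i = glue_perms l n \<rho> (q i)"
  proof cases
    case 1
    then obtain k a where ka: "k \<in> {1..n}" "a \<in> {1..l}" "i = (k - 1) * l + a"
      by (rule block_index_exists)
    have "q i = i" using q 1 by (intro permutes_not_in) (auto simp: mult.commute)
    moreover have "k \<in> {1..Suc n}" using ka by auto
    ultimately show ?thesis using ka by (simp add: glue_perms_apply del: atLeastAtMost_iff)
  next
    case 2
    then have "q i = n * l + \<rho> (Suc n) a"
      by (simp add: q_def map_permutation_apply)
    moreover have "\<rho> (Suc n) a \<in> {1..l}" using assms 2 by (simp add: permutes_in_image del: atLeastAtMost_iff)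
    then have "glue_perms l n \<rho> (n * l + \<rho> (Suc n) a) = n * l + \<rho> (Suc n) a"
      unfolding glue_perms_def by (intro blockwise_outside) (auto simp: mult.commute)
    moreover have "glue_perms l (Suc n) \<rho> i = n * l + \<rho> (Suc n) a"
      using glue_perms_apply[of "Suc n" "Suc n" a l \<rho>] 2 by simp
    ultimately show ?thesis by simp
  next
    case 3
    then have "q i = i" using q by (intro permutes_not_in) (auto simp: mult.commute)
    moreover have "i \<notin> {1..l * n}" using 3 by auto
    ultimately show ?thesis
      using 3 by (simp add: glue_perms_def blockwise_outside del: atLeastAtMost_iff)
  qed
  then show "glue_perms l (Suc n) \<rho> i = (glue_perms l n \<rho> \<circ> q) i" by simp
qed

text \<open>One induction yields both claims because multiplicativity of \<open>sign\<close> in the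
  step needs the glued map on the first \<open>n\<close> blocks to be a permutation.\<close>

lemma glue_perms_permutes_sign:
  assumes "\<And>k. k \<in> {1..n} \<Longrightarrow> \<rho> k permutes {1..l}"
  shows "glue_perms l n \<rho> permutes {1..l * n} \<and> sign (glue_perms l n \<rho>) = (\<Prod>k = 1..n. sign (\<rho> k))"
  using assms
proof (induction n)
  case 0
  have "glue_perms l 0 \<rho> = id" by (rule ext) (simp add: glue_perms_def blockwise_def)
  then show ?case by (simp del: id_apply add: id_def[symmetric])
next
  case (Suc n)
  define q where "q = map_permutation {1..l} (\<lambda>a. n * l + a) (\<rho> (Suc n))"
  have \<rho>: "\<rho> (Suc n) permutes {1..l}" using Suc.prems by simp
  have bij: "bij_betw (\<lambda>a. n * l + a) {1..l} {n * l + 1..n * l + l}"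
    by (simp add: bij_betw_def image_add_atLeastAtMost)
  then have q: "q permutes {n * l + 1..n * l + l}"
    unfolding q_def using \<rho> by (rule map_permutation_permutes)
  have IH: "glue_perms l n \<rho> permutes {1..l * n}"
    "sign (glue_perms l n \<rho>) = (\<Prod>k = 1..n. sign (\<rho> k))"
    using Suc by auto
  have "sign q = sign (\<rho> (Suc n))"
    unfolding q_def using \<rho> by (intro sign_map_permutation) auto
  moreover have "permutation q" "permutation (glue_perms l n \<rho>)"
    using q IH(1) by (auto intro: permutes_imp_permutation[rotated])
  ultimately have "sign (glue_perms l n \<rho> \<circ> q) = (\<Prod>k = 1..Suc n. sign (\<rho> k))"
    using IH(2) by (subst sign_compose) simp_all
  moreover have "glue_perms l n \<rho> permutes {1..l * Suc n}" "q permutes {1..l * Suc n}"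
    using q IH(1) by (auto intro: permutes_subset simp: mult.commute)
  then have "glue_perms l n \<rho> \<circ> q permutes {1..l * Suc n}"
    by (intro permutes_compose)
  moreover have eq: "glue_perms l (Suc n) \<rho> = glue_perms l n \<rho> \<circ> q"
    unfolding q_def using \<rho> by (rule glue_perms_Suc)
  ultimately show ?case
    unfolding eq by blast
qed

lemma glue_perms_image_interval:
  assumes "\<rho> k permutes {1..l}" "k \<in> {1..n}"
  shows "glue_perms l n \<rho> ` interval l k = interval l k"
proof -
  have "glue_perms l n \<rho> ` interval l k = (\<lambda>a. (k - 1) * l + \<rho> k a) ` {1..l}"
    using assms(2) by (simp only: interval_altdef atLeastAtMost_iff image_image)
      (intro image_cong refl, simp add: glue_perms_apply)
  also have "\<dots> = (\<lambda>a. (k - 1) * l + a) ` \<rho> k ` {1..l}" by (simp add: image_image)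
  finally show ?thesis
    using assms by (simp add: permutes_image interval_altdef)
qed

section \<open>Increasing enumerations of images of intervals\<close>

lemma sorted_list_of_set_image:
  assumes "strict_mono_on S f" "finite (S :: nat set)"
  shows "sorted_list_of_set (f ` S) = map f (sorted_list_of_set S)"
proof -
  have "sorted_wrt (<) (map f (sorted_list_of_set S))"
    unfolding sorted_wrt_map
    by (rule sorted_wrt_mono_rel[OF _ strict_sorted_list_of_set])
       (use assms in \<open>auto simp: strict_mono_on_def\<close>)
  then have "sorted_list_of_set (set (map f (sorted_list_of_set S))) = map f (sorted_list_of_set S)"
    by (intro sorted_list_of_set.idem_if_sorted_distinct) (auto simp: strict_sorted_iff)
  then show ?thesis using assms by simp
qed

lemma sorted_list_of_set_Icc: "sorted_list_of_set {a..b :: nat} = [a..<Suc b]"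
  by (metis atLeastLessThanSuc_atLeastAtMost sorted_list_of_set_range)

lemma nth_sorted_image_interval:
  assumes "strict_mono_on (interval l k) f" "k \<ge> 1" "a \<in> {1..l}"
  shows "sorted_list_of_set (f ` interval l k) ! (a - 1) = f ((k - 1) * l + a)"
proof -
  have "k * l = (k - 1) * l + l" using assms by (cases k) auto
  then have "interval l k = {(k - 1) * l + 1..(k - 1) * l + l}" by (simp add: interval_def)
  then have "sorted_list_of_set (f ` interval l k) = map f [(k - 1) * l + 1..<Suc ((k - 1) * l + l)]"
    using sorted_list_of_set_image[OF assms(1) finite_interval] by (simp only: sorted_list_of_set_Icc)
  moreover have "[(k - 1) * l + 1..<Suc ((k - 1) * l + l)] ! (a - 1) = (k - 1) * l + a"
    using assms(3) by (subst nth_upt) auto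
  moreover have "a - 1 < length [(k - 1) * l + 1..<Suc ((k - 1) * l + l)]"
    using assms(3) by (auto simp del: upt_Suc)
  ultimately show ?thesis
    by (simp only: nth_map)
qed

section \<open>Families of disjoint blocks\<close>

definition enum_set :: "nat set \<Rightarrow> nat \<Rightarrow> nat" where
  "enum_set P i = sorted_list_of_set P ! (i - 1)"

lemma subset_at_eq: "subset_at P I = enum_set P ` I"
  by (simp add: subset_at_def enum_set_def)

lemma strict_mono_on_enum_set:
  assumes "finite P"
  shows "strict_mono_on {1..card P} (enum_set P)"
proof (rule strict_mono_onI)
  fix i j assume "i \<in> {1..card P}" "j \<in> {1..card P}" "i < j"
  then have "i - 1 < j - 1" "j - 1 < length (sorted_list_of_set P)"
    using assms by auto
  then show "enum_set P i < enum_set P j"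
    unfolding enum_set_def using strict_sorted_list_of_set
    by (rule sorted_wrt_nth_less[rotated])
qed

lemma image_enum_set:
  assumes "finite P"
  shows "enum_set P ` {1..card P} = P"
proof -
  have "enum_set P ` {1..card P} = (\<lambda>i. sorted_list_of_set P ! i) ` (\<lambda>i. i - 1) ` {1..card P}"
    by (simp add: enum_set_def image_image)
  also have "(\<lambda>i. i - 1) ` {1..card P} = {0..<card P}"
    by (force intro: image_eqI[where x = "Suc _"] simp: One_nat_def)
  also have "(\<lambda>i. sorted_list_of_set P ! i) ` {0..<card P} = set (sorted_list_of_set P)"
    by (simp add: set_conv_nth) (use assms in auto)
  finally show ?thesis using assms by simp
qed

lemma inj_on_enum_set:
  "finite P \<Longrightarrow> inj_on (enum_set P) {1..card P}"
  by (rule strict_mono_on_imp_inj_on[OF strict_mono_on_enum_set])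

lemma bij_betw_enum_set:
  "finite P \<Longrightarrow> bij_betw (enum_set P) {1..card P} P"
  by (simp add: bij_betw_def inj_on_enum_set image_enum_set)

text \<open>A function that increases on an interval can be read back from the image set alone. This
  is how the sets \<open>\<sigma>\<^sub>k\<close> in a hyperpfaffian keep all the information on
  \<open>\<sigma>\<close>.\<close>

lemma enum_set_image_interval:
  assumes "strict_mono_on (interval l k) f" "k \<ge> 1" "a \<in> {1..l}"
  shows "enum_set (f ` interval l k) a = f ((k - 1) * l + a)"
  using nth_sorted_image_interval[OF assms] by (simp add: enum_set_def)

lemma enum_set_Icc: "i \<in> {1..n} \<Longrightarrow> enum_set {1..n} i = i"
  by (auto simp: enum_set_def sorted_list_of_set_Icc simp del: upt_Suc)

text \<open>The concatenation of the increasing enumerations of \<open>K 1\<close>, ...,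
  \<open>K n\<close>, as a function of the position.\<close>

definition word :: "nat \<Rightarrow> nat \<Rightarrow> (nat \<Rightarrow> nat set) \<Rightarrow> nat \<Rightarrow> nat" where
  "word l n K = blockwise l n (\<lambda>k. enum_set (K k))"

lemma word_apply:
  "k \<in> {1..n} \<Longrightarrow> a \<in> {1..l} \<Longrightarrow> word l n K ((k - 1) * l + a) = enum_set (K k) a"
  unfolding word_def by (rule blockwise_apply)

lemma word_image_interval:
  assumes "k \<in> {1..n}" "finite (K k)" "card (K k) = l"
  shows "word l n K ` interval l k = K k"
proof -
  have "word l n K ` interval l k = (\<lambda>a. word l n K ((k - 1) * l + a)) ` {1..l}"
    using assms(1) by (simp only: interval_altdef atLeastAtMost_iff image_image)
  also have "\<dots> = enum_set (K k) ` {1..l}"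
    using assms(1) by (intro image_cong refl word_apply)
  finally show ?thesis
    using image_enum_set[of "K k"] assms by simp
qed

lemma strict_mono_on_word:
  assumes "k \<in> {1..n}" "finite (K k)" "card (K k) = l"
  shows "strict_mono_on (interval l k) (word l n K)"
proof (rule strict_mono_onI)
  fix i j assume "i \<in> interval l k" "j \<in> interval l k" "i < j"
  moreover from this assms obtain a b where "a \<in> {1..l}" "i = (k - 1) * l + a"
    "b \<in> {1..l}" "j = (k - 1) * l + b" by (auto simp: interval_iff)
  ultimately show "word l n K i < word l n K j"
    using assms strict_mono_onD[OF strict_mono_on_enum_set[of "K k"], of a b]
    by (simp only: word_apply)
qed

lemma card_UN_blocks:
  assumes "\<And>k. k \<in> {1..n} \<Longrightarrow> finite (K k) \<and> card (K k) = l" "disjoint_family_on K {1..n}"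
  shows "card (\<Union>k\<in>{1..n}. K k) = l * n"
  using assms by (subst card_UN_disjoint) (auto simp: disjoint_family_on_def)

lemma word_image:
  assumes "\<And>k. k \<in> {1..n} \<Longrightarrow> finite (K k) \<and> card (K k) = l"
  shows "word l n K ` {1..l * n} = (\<Union>k\<in>{1..n}. K k)"
proof -
  have "word l n K ` {1..l * n} = (\<Union>k\<in>{1..n}. word l n K ` interval l k)"
    by (simp only: UN_interval[symmetric] image_UN)
  also have "\<dots> = (\<Union>k\<in>{1..n}. K k)"
    using assms by (intro SUP_cong refl word_image_interval) auto
  finally show ?thesis .
qed

text \<open>Each block is listed without repetition, so a letter can only repeat across two blocks
  that meet. For disjoint blocks the image has \<open>l * n\<close> elements, which forces
  injectivity; conversely an injective word sends the disjoint intervals to disjoint blocks.\<close>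

lemma word_inj_on_iff:
  assumes "\<And>k. k \<in> {1..n} \<Longrightarrow> finite (K k) \<and> card (K k) = l"
  shows "inj_on (word l n K) {1..l * n} \<longleftrightarrow> disjoint_family_on K {1..n}"
proof
  assume "disjoint_family_on K {1..n}"
  then have "card (word l n K ` {1..l * n}) = card {1..l * n}"
    using card_UN_blocks[of n K l] assms word_image[of n K l] by simp
  then show "inj_on (word l n K) {1..l * n}"
    by (intro eq_card_imp_inj_on) auto
next
  assume inj: "inj_on (word l n K) {1..l * n}"
  show "disjoint_family_on K {1..n}"
    unfolding disjoint_family_on_def
  proof (intro ballI impI)
    fix k k' assume kk: "k \<in> {1..n}" "k' \<in> {1..n}" "k \<noteq> k'"
    then have "word l n K ` interval l k \<inter> word l n K ` interval l k' = {}"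
      using inj_on_image_Int[OF inj interval_subset interval_subset, of k k'] interval_disjoint[of k k' l]
      by (simp del: atLeastAtMost_iff) auto
    then show "K k \<inter> K k' = {}"
      using kk assms word_image_interval[of k n K l] word_image_interval[of k' n K l] by simp
  qed
qed

text \<open>Cuts \<open>P\<close> into \<open>n\<close> blocks following the pattern
  \<open>\<tau>\<close>; block \<open>k\<close> is the index at which the hyperpfaffian of the
  subarray for \<open>P\<close> evaluates the original array. The restriction to
  \<open>{1..n}\<close> makes the family extensional, so that it can be the value of a bijection
  onto a subset of a \<open>PiE\<close> set.\<close>

definition block_family :: "nat \<Rightarrow> nat \<Rightarrow> nat set \<times> (nat \<Rightarrow> nat) \<Rightarrow> nat \<Rightarrow> nat set" where
  "block_family l n = (\<lambda>(P, \<tau>). \<lambda>k\<in>{1..n}. subset_at P (\<tau> ` interval l k))"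

lemma block_perms_permutes: "\<tau> \<in> block_perms l n \<Longrightarrow> \<tau> permutes {1..l * n}"
  by (simp add: block_perms_def)

lemma block_perms_strict_mono:
  "\<tau> \<in> block_perms l n \<Longrightarrow> k \<in> {1..n} \<Longrightarrow> strict_mono_on (interval l k) \<tau>"
  by (simp add: block_perms_def)

lemma block_perms_image_subset:
  "\<tau> \<in> block_perms l n \<Longrightarrow> k \<in> {1..n} \<Longrightarrow> \<tau> ` interval l k \<subseteq> {1..l * n}"
  using interval_subset block_perms_permutes permutes_image by (metis image_mono)

text \<open>\<open>enum_set P \<circ> \<tau>\<close> increases on every interval, so forgetting the
  order within a block and enumerating the block again changes nothing. Thus the word of the family
  is the enumeration of \<open>P\<close> with its positions permuted by
  \<open>\<tau>\<close>.\<close>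

lemma word_block_family:
  assumes "P \<in> nsets {1..N} (l * n)" "\<tau> \<in> block_perms l n" "i \<in> {1..l * n}"
  shows "word l n (block_family l n (P, \<tau>)) i = enum_set P (\<tau> i)"
proof -
  from assms(3) obtain k a where ka: "k \<in> {1..n}" "a \<in> {1..l}" "i = (k - 1) * l + a"
    by (rule block_index_exists)
  have P: "finite P" "card P = l * n" using assms(1) by (auto simp: nsets_def)
  have "strict_mono_on (interval l k) (enum_set P \<circ> \<tau>)"
  proof (rule strict_mono_onI)
    fix i j assume "i \<in> interval l k" "j \<in> interval l k" "i < j"
    then show "(enum_set P \<circ> \<tau>) i < (enum_set P \<circ> \<tau>) j"
      using strict_mono_onD[OF block_perms_strict_mono[OF assms(2) ka(1)]]
        strict_mono_onD[OF strict_mono_on_enum_set[OF P(1)], of "\<tau> i" "\<tau> j"]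
        block_perms_image_subset[OF assms(2) ka(1)] P
      by (auto simp del: atLeastAtMost_iff)
  qed
  from enum_set_image_interval[OF this, of a] ka
  have "enum_set ((enum_set P \<circ> \<tau>) ` interval l k) a = enum_set P (\<tau> i)"
    by simp
  with ka show ?thesis
    by (simp add: word_apply block_family_def subset_at_eq image_comp)
qed

lemma block_family_image:
  assumes "P \<in> nsets {1..N} (l * n)" "\<tau> \<in> block_perms l n"
  shows "block_family l n (P, \<tau>) \<in> {1..n} \<rightarrow>\<^sub>E nsets {1..N} l"
    and "disjoint_family_on (block_family l n (P, \<tau>)) {1..n}"
    and "(\<Union>k\<in>{1..n}. block_family l n (P, \<tau>) k) = P"
proof -
  have P: "finite P" "card P = l * n" "P \<subseteq> {1..N}" using assms(1) by (auto simp: nsets_def)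
  note \<tau> = block_perms_permutes[OF assms(2)]
  have bij: "bij_betw (enum_set P \<circ> \<tau>) {1..l * n} P"
    using permutes_imp_bij[OF \<tau>] bij_betw_enum_set[OF P(1)] P(2)
    by (auto intro: bij_betw_trans)
  then have inj: "inj_on (enum_set P \<circ> \<tau>) {1..l * n}" by (rule bij_betw_imp_inj_on)
  have eq: "block_family l n (P, \<tau>) k = (enum_set P \<circ> \<tau>) ` interval l k" if "k \<in> {1..n}" for k
    using that by (simp add: block_family_def subset_at_eq image_comp)
  have sub: "block_family l n (P, \<tau>) k \<subseteq> P" if "k \<in> {1..n}" for k
    unfolding eq[OF that] using interval_subset[OF that, of l] bij_betw_imp_surj_on[OF bij] by blast
  have card: "card (block_family l n (P, \<tau>) k) = l" if "k \<in> {1..n}" for k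
    unfolding eq[OF that]
    using that card_image[OF inj_on_subset[OF inj interval_subset[OF that]]] card_interval[of k l] by simp
  show "block_family l n (P, \<tau>) \<in> {1..n} \<rightarrow>\<^sub>E nsets {1..N} l"
  proof (rule PiE_I)
    fix k assume "k \<in> {1..n}"
    then show "block_family l n (P, \<tau>) k \<in> nsets {1..N} l"
      using sub card P finite_subset unfolding nsets_def by blast
  qed (auto simp: block_family_def)
  show "disjoint_family_on (block_family l n (P, \<tau>)) {1..n}"
    unfolding disjoint_family_on_def
  proof (intro ballI impI)
    fix k k' assume kk: "k \<in> {1..n}" "k' \<in> {1..n}" "k \<noteq> k'"
    then have "interval l k \<inter> interval l k' = {}" by (intro interval_disjoint) auto
    then show "block_family l n (P, \<tau>) k \<inter> block_family l n (P, \<tau>) k' = {}"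
      unfolding eq[OF kk(1)] eq[OF kk(2)]
      using inj_on_image_Int[OF inj interval_subset[OF kk(1)] interval_subset[OF kk(2)]] by simp
  qed
  show "(\<Union>k\<in>{1..n}. block_family l n (P, \<tau>) k) = P"
    using bij_betw_imp_surj_on[OF bij] UN_interval[where n = n and l = l] by (simp only: eq image_UN[symmetric] cong: SUP_cong)
qed

text \<open>The required \<open>\<tau>\<close> is the standardization of the word of
  \<open>K\<close>. Besides the surjectivity of \<open>block_family\<close>, this supplies the
  increasing coset representative in \<open>bij_betw_block_decomposition\<close>.\<close>

lemma block_family_surj:
  assumes K: "K \<in> {1..n} \<rightarrow>\<^sub>E nsets {1..N} l" and disj: "disjoint_family_on K {1..n}"
  obtains \<tau> where "\<tau> \<in> block_perms l n" "(\<Union>k\<in>{1..n}. K k) \<in> nsets {1..N} (l * n)"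
    "block_family l n (\<Union>k\<in>{1..n}. K k, \<tau>) = K"
proof -
  define P where "P = (\<Union>k\<in>{1..n}. K k)"
  have Kk: "finite (K k) \<and> card (K k) = l" "K k \<subseteq> {1..N}" if "k \<in> {1..n}" for k
    using PiE_mem[OF K that] by (auto simp: nsets_def)
  have P: "finite P" "card P = l * n" "P \<subseteq> {1..N}"
    unfolding P_def using Kk card_UN_blocks[OF Kk(1) disj] by blast+
  have e: "bij_betw (enum_set P) {1..l * n} P"
    using bij_betw_enum_set[OF P(1)] P(2) by simp
  have w: "bij_betw (word l n K) {1..l * n} P"
    unfolding bij_betw_def P_def using word_inj_on_iff[of n K l] word_image[of n K l] Kk(1) disj by blast
  \<comment> \<open>Each letter is replaced by its rank in the union \<open>P\<close>; points
    outside \<open>{1..l * n}\<close> are fixed, as \<open>permutes\<close> demands.\<close>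
  define \<tau> where "\<tau> i = (if i \<in> {1..l * n} then inv_into {1..l * n} (enum_set P) (word l n K i) else i)" for i
  have \<tau>_eq: "enum_set P (\<tau> i) = word l n K i" "\<tau> i \<in> {1..l * n}" if "i \<in> {1..l * n}" for i
    using that e w bij_betwE[OF w] bij_betw_imp_surj_on[OF e] f_inv_into_f[of "word l n K i" "enum_set P" "{1..l * n}"]
      inv_into_into[of "word l n K i" "enum_set P" "{1..l * n}"]
    unfolding \<tau>_def by auto
  have "bij_betw \<tau> {1..l * n} {1..l * n} \<longleftrightarrow> bij_betw (inv_into {1..l * n} (enum_set P) \<circ> word l n K) {1..l * n} {1..l * n}"
    by (rule bij_betw_cong) (simp add: \<tau>_def)
  then have "\<tau> permutes {1..l * n}"
    using bij_betw_trans[OF w bij_betw_inv_into[OF e]]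
    by (intro bij_imp_permutes) (auto simp: \<tau>_def)
  moreover have "strict_mono_on (interval l k) \<tau>" if k: "k \<in> {1..n}" for k
  proof (rule strict_mono_onI)
    fix i j assume ij: "i \<in> interval l k" "j \<in> interval l k" "i < j"
    then have r: "i \<in> {1..l * n}" "j \<in> {1..l * n}" using interval_subset[OF k] by blast+
    \<comment> \<open>The letters increase within a block, and ranks compare as the letters do
      because \<open>enum_set P\<close> is strictly increasing.\<close>
    have "enum_set P (\<tau> i) < enum_set P (\<tau> j)"
      unfolding \<tau>_eq(1)[OF r(1)] \<tau>_eq(1)[OF r(2)]
      using strict_mono_onD[OF strict_mono_on_word[where n = n and K = K and l = l and k = k]] Kk(1)[OF k] k ij by blast
    then show "\<tau> i < \<tau> j"
      using strict_mono_on_less[OF strict_mono_on_enum_set[OF P(1)], of "\<tau> i" "\<tau> j"] \<tau>_eq(2) r P(2) by simp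
  qed
  ultimately have "\<tau> \<in> block_perms l n" by (simp add: block_perms_def)
  moreover have "P \<in> nsets {1..N} (l * n)" using P by (simp add: nsets_def)
  moreover have "block_family l n (P, \<tau>) = K"
  proof
    fix k
    show "block_family l n (P, \<tau>) k = K k"
    proof (cases "k \<in> {1..n}")
      case True
      have "enum_set P ` \<tau> ` interval l k = word l n K ` interval l k"
        unfolding image_image using interval_subset[OF True] by (intro image_cong refl \<tau>_eq(1)) blast
      then show ?thesis
        using True word_image_interval[of k n K l] Kk(1)[OF True] by (simp add: block_family_def subset_at_eq)
    next
      case False
      then show ?thesis using PiE_arb[OF K False] by (auto simp: block_family_def)
    qed
  qed
  ultimately show ?thesis using that unfolding P_def by blast
qed

text \<open>\<open>P\<close> is recovered as the union of the blocks and \<open>\<tau>\<close> from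
  the word, since \<open>enum_set P\<close> is injective.\<close>

lemma bij_betw_block_family:
  "bij_betw (block_family l n) (nsets {1..N} (l * n) \<times> block_perms l n)
     {K \<in> {1..n} \<rightarrow>\<^sub>E nsets {1..N} l. disjoint_family_on K {1..n}}"
  unfolding bij_betw_def
proof
  show "inj_on (block_family l n) (nsets {1..N} (l * n) \<times> block_perms l n)"
  proof (rule inj_onI, clarify)
    fix P \<tau> P' \<tau>'
    assume P: "P \<in> nsets {1..N} (l * n)" "P' \<in> nsets {1..N} (l * n)"
      and \<tau>: "\<tau> \<in> block_perms l n" "\<tau>' \<in> block_perms l n"
      and eq: "block_family l n (P, \<tau>) = block_family l n (P', \<tau>')"
    have PP: "P = P'"
      using block_family_image(3)[OF P(1) \<tau>(1)] block_family_image(3)[OF P(2) \<tau>(2)] eq by simp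
    have fin: "finite P" "card P = l * n" using P(1) by (auto simp: nsets_def)
    have "\<tau> i = \<tau>' i" for i
    proof (cases "i \<in> {1..l * n}")
      case True
      then have "enum_set P (\<tau> i) = enum_set P (\<tau>' i)"
        using word_block_family[OF P(1) \<tau>(1) True] word_block_family[OF P(2) \<tau>(2) True] eq PP by simp
      moreover have "\<tau> i \<in> {1..l * n}" "\<tau>' i \<in> {1..l * n}"
        using True \<tau>[THEN block_perms_permutes] permutes_in_image by metis+
      ultimately show ?thesis
        using inj_onD[OF inj_on_enum_set[OF fin(1)]] fin(2) by metis
    next
      case False
      then show ?thesis using \<tau>[THEN block_perms_permutes] permutes_not_in by metis
    qed
    then show "P = P' \<and> \<tau> = \<tau>'" using PP by auto
  qed
  show "block_family l n ` (nsets {1..N} (l * n) \<times> block_perms l n)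
      = {K \<in> {1..n} \<rightarrow>\<^sub>E nsets {1..N} l. disjoint_family_on K {1..n}}"
  proof (intro equalityI subsetI)
    fix K assume "K \<in> block_family l n ` (nsets {1..N} (l * n) \<times> block_perms l n)"
    then show "K \<in> {K \<in> {1..n} \<rightarrow>\<^sub>E nsets {1..N} l. disjoint_family_on K {1..n}}"
      using block_family_image(1,2) by blast
  next
    fix K assume "K \<in> {K \<in> {1..n} \<rightarrow>\<^sub>E nsets {1..N} l. disjoint_family_on K {1..n}}"
    then obtain \<tau> where "\<tau> \<in> block_perms l n" "(\<Union>k\<in>{1..n}. K k) \<in> nsets {1..N} (l * n)"
      "block_family l n (\<Union>k\<in>{1..n}. K k, \<tau>) = K"
      using block_family_surj[of K n N l] by blast
    then show "K \<in> block_family l n ` (nsets {1..N} (l * n) \<times> block_perms l n)"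
      by (metis SigmaI image_eqI)
  qed
qed

section \<open>Factorization of permutations along blocks\<close>

lemma glue_perms_PiE:
  assumes "\<rho> \<in> {1..n} \<rightarrow>\<^sub>E {\<pi>. \<pi> permutes {1..l}}"
  shows "glue_perms l n \<rho> permutes {1..l * n}" "sign (glue_perms l n \<rho>) = (\<Prod>k = 1..n. sign (\<rho> k))"
proof -
  have "\<rho> k permutes {1..l}" if "k \<in> {1..n}" for k
    using PiE_mem[OF assms that] by simp
  then show "glue_perms l n \<rho> permutes {1..l * n}" "sign (glue_perms l n \<rho>) = (\<Prod>k = 1..n. sign (\<rho> k))"
    using glue_perms_permutes_sign[of n \<rho> l] by blast+
qed

text \<open>\<open>block_perms l n\<close> represents the left cosets of the Young subgroup.
  Composing with a glued permutation preserves the images of the intervals, and these images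
  determine the representative because it increases on each interval.\<close>

lemma bij_betw_block_decomposition:
  "bij_betw (\<lambda>(\<sigma>, \<rho>). \<sigma> \<circ> glue_perms l n \<rho>)
     (block_perms l n \<times> ({1..n} \<rightarrow>\<^sub>E {\<pi>. \<pi> permutes {1..l}})) {\<pi>. \<pi> permutes {1..l * n}}"
  unfolding bij_betw_def
proof
  show "inj_on (\<lambda>(\<sigma>, \<rho>). \<sigma> \<circ> glue_perms l n \<rho>)
     (block_perms l n \<times> ({1..n} \<rightarrow>\<^sub>E {\<pi>. \<pi> permutes {1..l}}))"
  proof (rule inj_onI, clarify)
    fix \<sigma> \<rho> \<sigma>' \<rho>'
    assume \<sigma>: "\<sigma> \<in> block_perms l n" "\<sigma>' \<in> block_perms l n"
      and \<rho>: "\<rho> \<in> {1..n} \<rightarrow>\<^sub>E {\<pi>. \<pi> permutes {1..l}}" "\<rho>' \<in> {1..n} \<rightarrow>\<^sub>E {\<pi>. \<pi> permutes {1..l}}"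
      and eq: "\<sigma> \<circ> glue_perms l n \<rho> = \<sigma>' \<circ> glue_perms l n \<rho>'"
    have \<rho>p: "\<rho> k permutes {1..l}" "\<rho>' k permutes {1..l}" if "k \<in> {1..n}" for k
      using PiE_mem[OF \<rho>(1) that] PiE_mem[OF \<rho>(2) that] by simp_all
    have img: "\<sigma> ` interval l k = \<sigma>' ` interval l k" if k: "k \<in> {1..n}" for k
    proof -
      have "\<sigma> ` interval l k = (\<sigma> \<circ> glue_perms l n \<rho>) ` interval l k"
        using glue_perms_image_interval[of \<rho> k l n] \<rho>p k by (simp only: image_comp[symmetric])
      also have "\<dots> = \<sigma>' ` interval l k"
        unfolding eq using glue_perms_image_interval[of \<rho>' k l n] \<rho>p k by (simp only: image_comp[symmetric])
      finally show ?thesis .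
    qed
    have "\<sigma> i = \<sigma>' i" for i
    proof (cases "i \<in> {1..l * n}")
      case True
      then obtain k a where ka: "k \<in> {1..n}" "a \<in> {1..l}" "i = (k - 1) * l + a"
        by (rule block_index_exists)
      then have "k \<ge> 1" by simp
      with ka show ?thesis
        using enum_set_image_interval[OF block_perms_strict_mono[OF \<sigma>(1)], of k a]
          enum_set_image_interval[OF block_perms_strict_mono[OF \<sigma>(2)], of k a] img by metis
    next
      case False
      then show ?thesis using \<sigma>[THEN block_perms_permutes] permutes_not_in by metis
    qed
    then have \<sigma>\<sigma>: "\<sigma> = \<sigma>'" by auto
    have glue: "glue_perms l n \<rho> i = glue_perms l n \<rho>' i" for i
      using fun_cong[OF eq, of i] permutes_inj[OF block_perms_permutes[OF \<sigma>(1)]] \<sigma>\<sigma>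
      by (auto dest: injD)
    have "\<rho> k = \<rho>' k" if k: "k \<in> {1..n}" for k
    proof
      fix a
      show "\<rho> k a = \<rho>' k a"
      proof (cases "a \<in> {1..l}")
        case True
        then show ?thesis
          using glue[of "(k - 1) * l + a"] glue_perms_apply[OF k True, of \<rho>] glue_perms_apply[OF k True, of \<rho>']
          by simp
      next
        case False
        then show ?thesis using \<rho>p[OF k] permutes_not_in by metis
      qed
    qed
    then have "\<rho> = \<rho>'" using \<rho> by (rule PiE_ext[rotated 2])
    with \<sigma>\<sigma> show "\<sigma> = \<sigma>' \<and> \<rho> = \<rho>'" by simp
  qed
  show "(\<lambda>(\<sigma>, \<rho>). \<sigma> \<circ> glue_perms l n \<rho>) `
     (block_perms l n \<times> ({1..n} \<rightarrow>\<^sub>E {\<pi>. \<pi> permutes {1..l}})) = {\<pi>. \<pi> permutes {1..l * n}}"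
  proof (intro equalityI subsetI)
    fix \<pi>
    assume "\<pi> \<in> (\<lambda>(\<sigma>, \<rho>). \<sigma> \<circ> glue_perms l n \<rho>) `
     (block_perms l n \<times> ({1..n} \<rightarrow>\<^sub>E {\<pi>. \<pi> permutes {1..l}}))"
    then obtain \<sigma> \<rho> where "\<pi> = \<sigma> \<circ> glue_perms l n \<rho>" "\<sigma> \<in> block_perms l n"
      "\<rho> \<in> {1..n} \<rightarrow>\<^sub>E {\<pi>. \<pi> permutes {1..l}}" by auto
    then show "\<pi> \<in> {\<pi>. \<pi> permutes {1..l * n}}"
      using permutes_compose block_perms_permutes glue_perms_PiE(1) by blast
  next
    fix \<pi> assume "\<pi> \<in> {\<pi>. \<pi> permutes {1..l * n}}"
    then have \<pi>: "\<pi> permutes {1..l * n}" by simp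
    \<comment> \<open>The representative of the coset of \<open>\<pi>\<close> has to have the same
      interval images; the disjoint family of these images produces it through
      \<open>block_family_surj\<close>.\<close>
    define K where "K = (\<lambda>k\<in>{1..n}. \<pi> ` interval l k)"
    have K: "K \<in> {1..n} \<rightarrow>\<^sub>E nsets {1..l * n} l"
    proof (rule PiE_I)
      fix k assume k: "k \<in> {1..n}"
      have "\<pi> ` interval l k \<subseteq> \<pi> ` {1..l * n}"
        using interval_subset[OF k] by (rule image_mono)
      moreover have "card (\<pi> ` interval l k) = l"
        using card_image[OF permutes_inj_on[OF \<pi>]] card_interval[of k l] k by simp
      ultimately show "K k \<in> nsets {1..l * n} l"
        using k finite_interval permutes_image[OF \<pi>] by (simp add: nsets_def K_def del: atLeastAtMost_iff)
    qed (auto simp: K_def)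
    have "disjoint_family_on K {1..n}"
      unfolding disjoint_family_on_def
    proof (intro ballI impI)
      fix k k' assume kk: "k \<in> {1..n}" "k' \<in> {1..n}" "k \<noteq> k'"
      then have "interval l k \<inter> interval l k' = {}" by (intro interval_disjoint) auto
      then show "K k \<inter> K k' = {}"
        using kk image_Int[OF permutes_inj[OF \<pi>], of "interval l k" "interval l k'"]
        by (simp add: K_def del: atLeastAtMost_iff)
    qed
    with K obtain \<tau> where \<tau>: "\<tau> \<in> block_perms l n" and
      U: "(\<Union>k\<in>{1..n}. K k) \<in> nsets {1..l * n} (l * n)"
      "block_family l n (\<Union>k\<in>{1..n}. K k, \<tau>) = K" by (rule block_family_surj)
    \<comment> \<open>A subset of \<open>{1..l * n}\<close> with \<open>l * n\<close> elements is
      everything, and its increasing enumeration is the identity. Hence the blocks of the family are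
      the interval images of \<open>\<tau>\<close> themselves.\<close>
    have "(\<Union>k\<in>{1..n}. K k) = {1..l * n}"
      using U(1) card_subset_eq[of "{1..l * n}" "(\<Union>k\<in>{1..n}. K k)"] unfolding nsets_def by simp
    with U(2) have fam: "block_family l n ({1..l * n}, \<tau>) = K" by (simp only:)
    have img: "\<tau> ` interval l k = \<pi> ` interval l k" if k: "k \<in> {1..n}" for k
    proof -
      have "\<tau> ` interval l k = enum_set {1..l * n} ` \<tau> ` interval l k"
      proof -
        have "enum_set {1..l * n} ` \<tau> ` interval l k = id ` \<tau> ` interval l k"
        proof (rule image_cong[OF refl])
          fix i assume "i \<in> \<tau> ` interval l k"
          then have "i \<in> {1..l * n}" using block_perms_image_subset[OF \<tau> k] by blast
          then show "enum_set {1..l * n} i = id i" by (simp only: enum_set_Icc id_apply)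
        qed
        then show ?thesis by simp
      qed
      also have "\<dots> = K k"
        unfolding fam[symmetric] using k by (simp add: block_family_def subset_at_eq)
      finally show ?thesis using k by (simp add: K_def)
    qed
    note \<tau>p = block_perms_permutes[OF \<tau>]
    \<comment> \<open>As \<open>\<tau>\<close> and \<open>\<pi>\<close> have equal interval images,
      \<open>\<psi>\<close> maps every interval to itself and must be the glued factor.\<close>
    define \<psi> where "\<psi> = inv \<tau> \<circ> \<pi>"
    have \<psi>: "inj \<psi>" "\<psi> ` interval l k = interval l k" if "k \<in> {1..n}" for k
    proof -
      show "inj \<psi>"
        unfolding \<psi>_def using permutes_inj[OF \<pi>] permutes_inj[OF permutes_inv[OF \<tau>p]] by (rule inj_compose[rotated])
      have "\<psi> ` interval l k = inv \<tau> ` \<tau> ` interval l k"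
        unfolding img[OF that] \<psi>_def by (rule image_comp[symmetric])
      then show "\<psi> ` interval l k = interval l k"
        using permutes_inverses[OF \<tau>p] by (simp add: image_image)
    qed
    \<comment> \<open>The restriction of \<open>\<psi>\<close> to the \<open>k\<close>-th interval,
      shifted down to \<open>{1..l}\<close>. The subtraction of naturals is exact because
      \<open>\<psi>\<close> stays in the interval.\<close>
    define \<rho> where "\<rho> = (\<lambda>k\<in>{1..n}. \<lambda>a. if a \<in> {1..l} then \<psi> ((k - 1) * l + a) - (k - 1) * l else a)"
    have \<rho>1: "\<rho> k a \<in> {1..l}" "(k - 1) * l + \<rho> k a = \<psi> ((k - 1) * l + a)" if "k \<in> {1..n}" "a \<in> {1..l}" for k a
    proof -
      have "k \<ge> 1" using that by simp
      then have "(k - 1) * l + a \<in> interval l k" using that by (auto simp: interval_iff)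
      then have "\<psi> ((k - 1) * l + a) \<in> interval l k" using \<psi>(2)[OF that(1)] by blast
      then obtain b where "b \<in> {1..l}" "\<psi> ((k - 1) * l + a) = (k - 1) * l + b"
        using \<open>k \<ge> 1\<close> by (auto simp: interval_iff)
      then show "\<rho> k a \<in> {1..l}" "(k - 1) * l + \<rho> k a = \<psi> ((k - 1) * l + a)"
        using that by (auto simp: \<rho>_def)
    qed
    have \<rho>2: "\<rho> k permutes {1..l}" if k: "k \<in> {1..n}" for k
    proof (rule bij_imp_permutes)
      have "inj_on (\<rho> k) {1..l}"
      proof (rule inj_onI)
        fix a b assume "a \<in> {1..l}" "b \<in> {1..l}" "\<rho> k a = \<rho> k b"
        then have "\<psi> ((k - 1) * l + a) = \<psi> ((k - 1) * l + b)"
          using \<rho>1(2)[OF k] by metis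
        then have "(k - 1) * l + a = (k - 1) * l + b" by (rule injD[OF \<psi>(1)[OF k]])
        then show "a = b" by simp
      qed
      moreover have "\<rho> k ` {1..l} \<subseteq> {1..l}" using \<rho>1(1)[OF k] by blast
      ultimately show "bij_betw (\<rho> k) {1..l} {1..l}"
        using endo_inj_surj[of "{1..l}" "\<rho> k"] by (auto simp: bij_betw_def)
    qed (use k in \<open>auto simp: \<rho>_def\<close>)
    have "\<pi> = \<tau> \<circ> glue_perms l n \<rho>"
    proof
      fix i
      show "\<pi> i = (\<tau> \<circ> glue_perms l n \<rho>) i"
      proof (cases "i \<in> {1..l * n}")
        case True
        then obtain k a where ka: "k \<in> {1..n}" "a \<in> {1..l}" "i = (k - 1) * l + a"
          by (rule block_index_exists)
        have "glue_perms l n \<rho> i = \<psi> i"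
          using glue_perms_apply[OF ka(1,2)] \<rho>1(2)[OF ka(1,2)] ka(3) by simp
        then show ?thesis
          using permutes_inverses(1)[OF \<tau>p] by (simp add: \<psi>_def)
      next
        case False
        then have "glue_perms l n \<rho> i = i"
          unfolding glue_perms_def by (rule blockwise_outside)
        then show ?thesis
          using permutes_not_in[OF \<pi> False] permutes_not_in[OF \<tau>p False] by simp
      qed
    qed
    moreover have "\<rho> \<in> {1..n} \<rightarrow>\<^sub>E {\<pi>. \<pi> permutes {1..l}}"
    proof (rule PiE_I)
      show "\<rho> k \<in> {\<pi>. \<pi> permutes {1..l}}" if "k \<in> {1..n}" for k
        using \<rho>2[OF that] by simp
      show "\<rho> k = undefined" if "k \<notin> {1..n}" for k
        using that unfolding \<rho>_def by (simp only: restrict_def if_False)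
    qed
    ultimately show "\<pi> \<in> (\<lambda>(\<sigma>, \<rho>). \<sigma> \<circ> glue_perms l n \<rho>) `
     (block_perms l n \<times> ({1..n} \<rightarrow>\<^sub>E {\<pi>. \<pi> permutes {1..l}}))"
      using \<tau> by (intro image_eqI[where x = "(\<tau>, \<rho>)"]) auto
  qed
qed

lemma sign_comp_block_decomposition:
  assumes "\<sigma> \<in> block_perms l n" "\<rho> \<in> {1..n} \<rightarrow>\<^sub>E {\<pi>. \<pi> permutes {1..l}}"
  shows "sign (\<sigma> \<circ> glue_perms l n \<rho>) = sign \<sigma> * (\<Prod>k = 1..n. sign (\<rho> k))"
proof -
  note g = glue_perms_PiE[OF assms(2)]
  have "permutation \<sigma>" "permutation (glue_perms l n \<rho>)"
    using g(1) block_perms_permutes[OF assms(1)] by (auto intro: permutes_imp_permutation[rotated])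
  then show ?thesis using g(2) by (simp add: sign_compose)
qed

section \<open>The alternating sum of a tensor\<close>

text \<open>This is \<open>T\<^sub>s(w)\<close> for \<open>d = m - 1\<close> and
  \<open>H = H(s)\<close>. The last index follows an arbitrary \<open>w\<close>, so words with
  repeated letters are covered as well.\<close>

definition alternating_sum :: "nat \<Rightarrow> nat \<Rightarrow> (nat list \<Rightarrow> 'a) \<Rightarrow> (nat \<Rightarrow> nat) \<Rightarrow> 'a::comm_ring_1" where
  "alternating_sum d L H w =
     (\<Sum>\<pi>s\<in>nlists d {\<pi>. \<pi> permutes {1..L}}.
        of_int (prod_list (map sign \<pi>s)) * (\<Prod>i = 1..L. H (map (\<lambda>\<pi>. \<pi> i) \<pi>s @ [w i])))"

lemma alternating_sum_cong:
  assumes "\<And>i. i \<in> {1..L} \<Longrightarrow> w i = w' i"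
  shows "alternating_sum d L H w = alternating_sum d L H w'"
  unfolding alternating_sum_def using assms by (auto intro!: sum.cong prod.cong arg_cong2[where f = "(*)"])

lemma nlists_nthD: "xs \<in> nlists n X \<Longrightarrow> x \<in> set xs \<Longrightarrow> x \<in> X"
  using nlistsE_set by blast

section \<open>Signs of lists of permutations and translation by a fixed permutation\<close>

lemma sign_foldr_comp:
  assumes "\<And>\<sigma>. \<sigma> \<in> set \<sigma>s \<Longrightarrow> permutation \<sigma>"
  shows "sign (foldr (\<circ>) \<sigma>s id) = prod_list (map sign \<sigma>s)"
proof -
  have "permutation (foldr (\<circ>) \<sigma>s id) \<and> sign (foldr (\<circ>) \<sigma>s id) = prod_list (map sign \<sigma>s)"
    using assms
  proof (induction \<sigma>s)
    case Nil
    show ?case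
      unfolding foldr_Nil id_def using permutation_id[unfolded id_def] by simp
  next
    case (Cons \<sigma> \<sigma>s)
    have \<sigma>: "permutation \<sigma>" by (rule Cons.prems) simp
    have "permutation (foldr (\<circ>) \<sigma>s id) \<and> sign (foldr (\<circ>) \<sigma>s id) = prod_list (map sign \<sigma>s)"
      by (rule Cons.IH, rule Cons.prems) simp
    then have IH: "permutation (foldr (\<circ>) \<sigma>s id)" "sign (foldr (\<circ>) \<sigma>s id) = prod_list (map sign \<sigma>s)"
      by blast+
    have "foldr (\<circ>) (\<sigma> # \<sigma>s) id = \<sigma> \<circ> foldr (\<circ>) \<sigma>s id" by (simp only: foldr.simps o_apply)
    then show ?case
      using permutation_compose[OF \<sigma> IH(1)] sign_compose[OF \<sigma> IH(1)] IH(2)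
      by (simp only: list.map prod_list.Cons simp_thms)
  qed
  then show ?thesis by simp
qed

lemma prod_list_sign_comp:
  assumes "\<And>\<pi>. \<pi> \<in> set \<pi>s \<Longrightarrow> permutation \<pi>" "permutation \<tau>"
  shows "prod_list (map sign (map (\<lambda>\<pi>. \<pi> \<circ> \<tau>) \<pi>s)) = prod_list (map sign \<pi>s) * sign \<tau> ^ length \<pi>s"
  using assms(1)
proof (induction \<pi>s)
  case (Cons \<pi> \<pi>s)
  have "prod_list (map sign (map (\<lambda>\<pi>. \<pi> \<circ> \<tau>) (\<pi> # \<pi>s)))
    = sign (\<pi> \<circ> \<tau>) * prod_list (map sign (map (\<lambda>\<pi>. \<pi> \<circ> \<tau>) \<pi>s))" by (simp only: list.map prod_list.Cons)
  also have "\<dots> = (sign \<pi> * sign \<tau>) * (prod_list (map sign \<pi>s) * sign \<tau> ^ length \<pi>s)"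
    using Cons assms(2) by (subst Cons.IH) (simp_all only: sign_compose list.set insert_iff simp_thms)
  finally show ?case by (simp add: mult_ac del: o_apply)
qed simp

lemma nlists_permutation:
  "\<pi>s \<in> nlists d {\<pi>. \<pi> permutes {1..L::nat}} \<Longrightarrow> \<pi> \<in> set \<pi>s \<Longrightarrow> permutation \<pi>"
  by (rule permutes_imp_permutation[of "{1..L}"]) (auto dest: nlists_nthD)

lemma bij_betw_permutes_comp:
  assumes "\<tau> permutes S"
  shows "bij_betw (\<lambda>\<pi>. \<pi> \<circ> \<tau>) {\<pi>. \<pi> permutes S} {\<pi>. \<pi> permutes S}"
proof (rule bij_betw_byWitness[where f' = "\<lambda>\<pi>. \<pi> \<circ> inv \<tau>"])
  show "\<forall>\<pi>\<in>{\<pi>. \<pi> permutes S}. (\<pi> \<circ> \<tau>) \<circ> inv \<tau> = \<pi>"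
    using permutes_inv_o(1)[OF assms] by (simp only: o_assoc[symmetric] o_id ball_simps) simp
  show "\<forall>\<pi>\<in>{\<pi>. \<pi> permutes S}. (\<pi> \<circ> inv \<tau>) \<circ> \<tau> = \<pi>"
    using permutes_inv_o(2)[OF assms] by (simp only: o_assoc[symmetric] o_id ball_simps) simp
  show "(\<lambda>\<pi>. \<pi> \<circ> \<tau>) ` {\<pi>. \<pi> permutes S} \<subseteq> {\<pi>. \<pi> permutes S}"
    using permutes_compose[OF assms] by blast
  show "(\<lambda>\<pi>. \<pi> \<circ> inv \<tau>) ` {\<pi>. \<pi> permutes S} \<subseteq> {\<pi>. \<pi> permutes S}"
    using permutes_compose[OF permutes_inv[OF assms]] by blast
qed

text \<open>Right translation by \<open>\<tau>\<close> is a bijection of the permutations. Applied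
  to all \<open>d\<close> entries of the list, it costs one factor \<open>sign \<tau>\<close> for
  each entry.\<close>

lemma sum_nlists_permutes_comp:
  fixes L :: nat and F :: "(nat \<Rightarrow> nat) list \<Rightarrow> 'a::comm_ring_1"
  assumes "\<tau> permutes {1..L}"
  shows "(\<Sum>\<pi>s\<in>nlists d {\<pi>. \<pi> permutes {1..L}}. of_int (prod_list (map sign \<pi>s)) * F \<pi>s)
    = of_int (sign \<tau> ^ d) *
      (\<Sum>\<pi>s\<in>nlists d {\<pi>. \<pi> permutes {1..L}}. of_int (prod_list (map sign \<pi>s)) * F (map (\<lambda>\<pi>. \<pi> \<circ> \<tau>) \<pi>s))"
proof -
  have "permutation \<tau>" using assms by (rule permutes_imp_permutation[rotated]) simp
  have "(\<Sum>\<pi>s\<in>nlists d {\<pi>. \<pi> permutes {1..L}}. of_int (prod_list (map sign \<pi>s)) * F \<pi>s)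
    = (\<Sum>\<pi>s\<in>nlists d {\<pi>. \<pi> permutes {1..L}}.
        of_int (prod_list (map sign (map (\<lambda>\<pi>. \<pi> \<circ> \<tau>) \<pi>s))) * F (map (\<lambda>\<pi>. \<pi> \<circ> \<tau>) \<pi>s))"
    by (rule sum_nlists_reindex[OF bij_betw_permutes_comp[OF assms]]) (simp add: finite_permutations)
  also have "\<dots> = (\<Sum>\<pi>s\<in>nlists d {\<pi>. \<pi> permutes {1..L}}.
        of_int (sign \<tau> ^ d) * (of_int (prod_list (map sign \<pi>s)) * F (map (\<lambda>\<pi>. \<pi> \<circ> \<tau>) \<pi>s)))"
  proof (rule sum.cong[OF refl])
    fix \<pi>s assume \<pi>s: "\<pi>s \<in> nlists d {\<pi>. \<pi> permutes {1..L}}"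
    have "prod_list (map sign (map (\<lambda>\<pi>. \<pi> \<circ> \<tau>) \<pi>s)) = prod_list (map sign \<pi>s) * sign \<tau> ^ d"
      using prod_list_sign_comp[OF nlists_permutation[OF \<pi>s] \<open>permutation \<tau>\<close>] \<pi>s by (simp only: nlistsE_length)
    then show "of_int (prod_list (map sign (map (\<lambda>\<pi>. \<pi> \<circ> \<tau>) \<pi>s))) * F (map (\<lambda>\<pi>. \<pi> \<circ> \<tau>) \<pi>s)
      = of_int (sign \<tau> ^ d) * (of_int (prod_list (map sign \<pi>s)) * F (map (\<lambda>\<pi>. \<pi> \<circ> \<tau>) \<pi>s))"
      by (simp only: of_int_mult mult_ac)
  qed
  finally show ?thesis by (simp only: sum_distrib_left)
qed

text \<open>After all summation permutations are translated by \<open>\<tau>\<close>, the factor at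
  \<open>i\<close> depends on \<open>i\<close> only through \<open>\<tau> i\<close>, so the product
  over positions loses \<open>\<tau>\<close> altogether and only the sign remains.\<close>

lemma alternating_sum_comp:
  assumes "\<tau> permutes {1..L}"
  shows "alternating_sum d L H (w \<circ> \<tau>) = of_int (sign \<tau> ^ d) * alternating_sum d L H w"
proof -
  have "alternating_sum d L H (w \<circ> \<tau>) = of_int (sign \<tau> ^ d) *
     (\<Sum>\<pi>s\<in>nlists d {\<pi>. \<pi> permutes {1..L}}.
        of_int (prod_list (map sign \<pi>s)) *
        (\<Prod>i = 1..L. H (map (\<lambda>\<pi>. \<pi> i) (map (\<lambda>\<pi>. \<pi> \<circ> \<tau>) \<pi>s) @ [(w \<circ> \<tau>) i])))"
    unfolding alternating_sum_def by (rule sum_nlists_permutes_comp[OF assms])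
  also have "(\<lambda>\<pi>s. \<Prod>i = 1..L. H (map (\<lambda>\<pi>. \<pi> i) (map (\<lambda>\<pi>. \<pi> \<circ> \<tau>) \<pi>s) @ [(w \<circ> \<tau>) i]))
    = (\<lambda>\<pi>s. \<Prod>i = 1..L. H (map (\<lambda>\<pi>. \<pi> i) \<pi>s @ [w i]))"
  proof
    fix \<pi>s :: "(nat \<Rightarrow> nat) list"
    show "(\<Prod>i = 1..L. H (map (\<lambda>\<pi>. \<pi> i) (map (\<lambda>\<pi>. \<pi> \<circ> \<tau>) \<pi>s) @ [(w \<circ> \<tau>) i]))
      = (\<Prod>i = 1..L. H (map (\<lambda>\<pi>. \<pi> i) \<pi>s @ [w i]))"
      using prod.permute[OF assms, of "\<lambda>i. H (map (\<lambda>\<pi>. \<pi> i) \<pi>s @ [w i])"] by (simp add: o_def)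
  qed
  finally show ?thesis unfolding alternating_sum_def .
qed

text \<open>Transposing two positions with equal letters fixes the word but, for odd
  \<open>d\<close>, negates the sum. A value equal to its own negative is zero in characteristic
  0.\<close>

lemma alternating_sum_eq_0:
  fixes H :: "nat list \<Rightarrow> 'a::field_char_0"
  assumes "odd d" "\<not> inj_on w {1..L}"
  shows "alternating_sum d L H w = 0"
proof -
  obtain i j where ij: "i \<in> {1..L}" "j \<in> {1..L}" "i \<noteq> j" "w i = w j"
    using assms(2) by (auto simp: inj_on_def)
  have "w \<circ> Transposition.transpose i j = w"
    using ij(4) by (auto simp: fun_eq_iff Transposition.transpose_def)
  then have "alternating_sum d L H w = of_int (sign (Transposition.transpose i j) ^ d) * alternating_sum d L H w"
    using alternating_sum_comp[OF permutes_swap_id[OF ij(1,2)], of d H w] by (simp only:)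
  then have "alternating_sum d L H w = - alternating_sum d L H w"
    using ij(3) assms(1) by (simp add: sign_swap_id)
  then show ?thesis by (simp only: eq_neg_iff_add_eq_0 mult_2[symmetric] mult_eq_0_iff) simp
qed

text \<open>Reindexing by the inverse of the last permutation moves the identity from the first to the
  last index; the total sign is unchanged because \<open>m - 1\<close> is odd.\<close>

lemma hyperdet_eq_alternating_sum:
  assumes "even m" "m > 0"
  shows "hyperdet m t A = alternating_sum (m - 1) t A id"
proof -
  define S where "S = {\<pi>. \<pi> permutes {1..t}}"
  have "m \<ge> 2" using assms by presburger
  define e where "e = m - 2"
  then have m: "m - 1 = e + 1" and e: "even e"
    using assms \<open>m \<ge> 2\<close> by simp_all
  have fin: "finite S" unfolding S_def by (simp add: finite_permutations)
  have one: "(\<Sum>ys\<in>nlists 1 S. F ys) = (\<Sum>\<tau>\<in>S. F [\<tau>])" for F :: "(nat \<Rightarrow> nat) list \<Rightarrow> 'a"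
    using sum_nlists_Suc[OF fin, of F 0] by (simp add: One_nat_def)
  have "hyperdet m t A = (\<Sum>\<sigma>s\<in>nlists (e + 1) S.
      of_int (prod_list (map sign \<sigma>s)) * (\<Prod>i = 1..t. A (i # map (\<lambda>\<sigma>. \<sigma> i) \<sigma>s)))"
    unfolding hyperdet_def m S_def[symmetric]
  proof (rule sum.cong[OF refl])
    fix \<sigma>s assume "\<sigma>s \<in> nlists (e + 1) S"
    then have "sign (foldr (\<circ>) \<sigma>s id) = prod_list (map sign \<sigma>s)"
      unfolding S_def by (intro sign_foldr_comp nlists_permutation)
    then show "of_int (sign (foldr (\<circ>) \<sigma>s id)) * (\<Prod>i = 1..t. A (i # map (\<lambda>\<sigma>. \<sigma> i) \<sigma>s))
      = of_int (prod_list (map sign \<sigma>s)) * (\<Prod>i = 1..t. A (i # map (\<lambda>\<sigma>. \<sigma> i) \<sigma>s))" by (simp only:)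
  qed
  also have "\<dots> = (\<Sum>\<rho>s\<in>nlists e S. \<Sum>\<tau>\<in>S. of_int (prod_list (map sign \<rho>s)) *
      (of_int (sign \<tau>) * (\<Prod>i = 1..t. A (i # map (\<lambda>\<sigma>. \<sigma> i) \<rho>s @ [\<tau> i]))))"
    by (simp add: sum_nlists_append[OF fin] one mult.assoc)
  also have "\<dots> = (\<Sum>\<tau>\<in>S. \<Sum>\<rho>s\<in>nlists e S. of_int (prod_list (map sign \<rho>s)) *
      (of_int (sign \<tau>) * (\<Prod>i = 1..t. A (i # map (\<lambda>\<sigma>. \<sigma> i) \<rho>s @ [\<tau> i]))))"
    by (rule sum.swap)
  also have "\<dots> = (\<Sum>\<tau>\<in>S. \<Sum>\<pi>s\<in>nlists e S. of_int (prod_list (map sign \<pi>s)) *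
      (of_int (sign (inv \<tau>)) * (\<Prod>j = 1..t. A (inv \<tau> j # map (\<lambda>\<sigma>. \<sigma> j) \<pi>s @ [j]))))"
  proof (rule sum.cong[OF refl])
    fix \<tau> assume "\<tau> \<in> S"
    then have \<tau>: "\<tau> permutes {1..t}" by (simp add: S_def)
    then have "permutation \<tau>" by (rule permutes_imp_permutation[rotated]) simp
    \<comment> \<open>Only the \<open>e = m - 2\<close> permutations other than the last are
      translated by \<open>\<tau>\<close>, so the signs they pick up cancel; the last one becomes
      its inverse, which has the same sign.\<close>
    have sgn: "sign \<tau> ^ e = 1"
      using e by (cases \<tau> rule: sign_cases) simp_all
    have "(\<Prod>i = 1..t. A (i # map (\<lambda>\<sigma>. \<sigma> i) (map (\<lambda>\<pi>. \<pi> \<circ> \<tau>) \<pi>s) @ [\<tau> i]))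
      = (\<Prod>j = 1..t. A (inv \<tau> j # map (\<lambda>\<sigma>. \<sigma> j) \<pi>s @ [j]))" for \<pi>s
      using prod.permute[OF \<tau>, of "\<lambda>j. A (inv \<tau> j # map (\<lambda>\<sigma>. \<sigma> j) \<pi>s @ [j])"] permutes_inverses(2)[OF \<tau>]
      by (simp add: o_def)
    then show "(\<Sum>\<rho>s\<in>nlists e S. of_int (prod_list (map sign \<rho>s)) *
      (of_int (sign \<tau>) * (\<Prod>i = 1..t. A (i # map (\<lambda>\<sigma>. \<sigma> i) \<rho>s @ [\<tau> i]))))
      = (\<Sum>\<pi>s\<in>nlists e S. of_int (prod_list (map sign \<pi>s)) *
      (of_int (sign (inv \<tau>)) * (\<Prod>j = 1..t. A (inv \<tau> j # map (\<lambda>\<sigma>. \<sigma> j) \<pi>s @ [j]))))"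
      unfolding S_def sign_inverse[OF \<open>permutation \<tau>\<close>]
      using sum_nlists_permutes_comp[OF \<tau>, where d = e and F = "\<lambda>\<rho>s. of_int (sign \<tau>) *
        (\<Prod>i = 1..t. A (i # map (\<lambda>\<sigma>. \<sigma> i) \<rho>s @ [\<tau> i]))"]
      by (simp only: sgn of_int_1 mult_1)
  qed
  also have "\<dots> = (\<Sum>\<tau>\<in>S. \<Sum>\<pi>s\<in>nlists e S. of_int (prod_list (map sign \<pi>s)) *
      (of_int (sign \<tau>) * (\<Prod>j = 1..t. A (\<tau> j # map (\<lambda>\<sigma>. \<sigma> j) \<pi>s @ [j]))))"
    unfolding S_def by (rule sum_permutations_inverse[symmetric])
  also have "\<dots> = alternating_sum (m - 1) t A id"
    unfolding alternating_sum_def m S_def[symmetric] Suc_eq_plus1[symmetric]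
    by (simp add: sum_nlists_Suc[OF fin] mult_ac)
  finally show ?thesis .
qed

lemma hyperdet_subtensor:
  assumes "even m" "m > 0" "length Js = m - 1"
  shows "hyperdet m t (subtensor H (map sorted_list_of_set (Js @ [K]))) =
    (\<Sum>\<pi>s\<in>nlists (m - 1) {\<pi>. \<pi> permutes {1..t}}. of_int (prod_list (map sign \<pi>s)) *
       (\<Prod>a = 1..t. H (map2 (\<lambda>J \<pi>. enum_set J (\<pi> a)) Js \<pi>s @ [enum_set K a])))"
proof -
  have "subtensor H (map sorted_list_of_set (Js @ [K])) (map (\<lambda>\<pi>. \<pi> a) \<pi>s @ [id a])
    = H (map2 (\<lambda>J \<pi>. enum_set J (\<pi> a)) Js \<pi>s @ [enum_set K a])"
    if "\<pi>s \<in> nlists (m - 1) {\<pi>. \<pi> permutes {1..t}}" for \<pi>s a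
    using that assms(3)
    by (simp add: subtensor_def enum_set_def map2_map_map zip_map1 zip_map2 case_prod_unfold o_def)
  then show ?thesis
    unfolding hyperdet_eq_alternating_sum[OF assms(1,2)] alternating_sum_def
    by (intro sum.cong refl) (simp only:)
qed

section \<open>Laplace expansion\<close>

lemma finite_block_perms: "finite (block_perms l n)"
  by (rule finite_subset[OF _ finite_permutations[of "{1..l * n}"]]) (auto simp: block_perms_def)

lemma finite_PiE_permutes: "finite ({1..n::nat} \<rightarrow>\<^sub>E {\<pi>. \<pi> permutes {1..l::nat}})"
  by (intro finite_PiE) (simp_all add: finite_permutations)

lemma prod_list_sign_block_decomposition:
  assumes "set zs \<subseteq> block_perms l n \<times> ({1..n} \<rightarrow>\<^sub>E {\<pi>. \<pi> permutes {1..l}})"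
  shows "prod_list (map sign (map (\<lambda>(\<sigma>, \<rho>). \<sigma> \<circ> glue_perms l n \<rho>) zs))
    = prod_list (map sign (map fst zs)) * (\<Prod>k = 1..n. prod_list (map sign (map (\<lambda>\<rho>. \<rho> k) (map snd zs))))"
  using assms
proof (induction zs)
  case (Cons z zs)
  obtain \<sigma> \<rho> where z: "z = (\<sigma>, \<rho>)" by (cases z)
  have "prod_list (map sign (map (\<lambda>(\<sigma>, \<rho>). \<sigma> \<circ> glue_perms l n \<rho>) (z # zs)))
    = sign (\<sigma> \<circ> glue_perms l n \<rho>) * prod_list (map sign (map (\<lambda>(\<sigma>, \<rho>). \<sigma> \<circ> glue_perms l n \<rho>) zs))"
    unfolding z by (simp only: list.map prod_list.Cons prod.case)
  also have "sign (\<sigma> \<circ> glue_perms l n \<rho>) = sign \<sigma> * (\<Prod>k = 1..n. sign (\<rho> k))"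
    using Cons.prems z by (intro sign_comp_block_decomposition) auto
  also have "prod_list (map sign (map (\<lambda>(\<sigma>, \<rho>). \<sigma> \<circ> glue_perms l n \<rho>) zs))
    = prod_list (map sign (map fst zs)) * (\<Prod>k = 1..n. prod_list (map sign (map (\<lambda>\<rho>. \<rho> k) (map snd zs))))"
    by (rule Cons.IH) (use Cons.prems in simp)
  finally show ?case
    unfolding z by (simp only: list.map prod_list.Cons fst_conv snd_conv prod.distrib mult_ac)
qed simp

text \<open>Expanding the small hyperdeterminants attaches to each \<open>\<sigma>\<close> a
  permutation \<open>\<rho> k\<close> of every block. The composite
  \<open>\<sigma> \<circ> glue_perms l n \<rho>\<close> then runs exactly once through all
  permutations of \<open>{1..l * n}\<close>, with multiplicative sign. For \<open>m = 2\<close> this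
  is the generalized Laplace expansion of a determinant along \<open>n\<close> groups of
  \<open>l\<close> columns.\<close>

lemma laplace_expansion:
  assumes "even m" "m > 0" and K: "\<And>k. k \<in> {1..n} \<Longrightarrow> finite (K k) \<and> card (K k) = l"
  shows "(\<Sum>\<sigma>s\<in>nlists (m - 1) (block_perms l n). of_int (prod_list (map sign \<sigma>s)) *
      (\<Prod>k = 1..n. hyperdet m l (subtensor H
         (map sorted_list_of_set (map (\<lambda>\<sigma>. \<sigma> ` interval l k) \<sigma>s @ [K k])))))
    = alternating_sum (m - 1) (l * n) H (word l n K)"
proof -
  define S where "S = {1..n} \<rightarrow>\<^sub>E {\<pi>. \<pi> permutes {1..l}}"
  define h where "h k a \<sigma>s \<pi>s = H (map2 (\<lambda>J \<pi>. enum_set J (\<pi> a)) (map (\<lambda>\<sigma>. \<sigma> ` interval l k) \<sigma>s) \<pi>s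
      @ [enum_set (K k) a])" for k a and \<sigma>s \<pi>s :: "(nat \<Rightarrow> nat) list"
  have "(\<Sum>\<sigma>s\<in>nlists (m - 1) (block_perms l n). of_int (prod_list (map sign \<sigma>s)) *
      (\<Prod>k = 1..n. hyperdet m l (subtensor H
         (map sorted_list_of_set (map (\<lambda>\<sigma>. \<sigma> ` interval l k) \<sigma>s @ [K k])))))
    = (\<Sum>\<sigma>s\<in>nlists (m - 1) (block_perms l n). of_int (prod_list (map sign \<sigma>s)) *
      (\<Prod>k = 1..n. \<Sum>\<pi>s\<in>nlists (m - 1) {\<pi>. \<pi> permutes {1..l}}.
         of_int (prod_list (map sign \<pi>s)) * (\<Prod>a = 1..l. h k a \<sigma>s \<pi>s)))"
    unfolding h_def using assms(1,2)
    by (intro sum.cong refl arg_cong2[where f = "(*)"] prod.cong hyperdet_subtensor) simp_all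
  also have "\<dots> = (\<Sum>\<sigma>s\<in>nlists (m - 1) (block_perms l n). \<Sum>\<rho>s\<in>nlists (m - 1) S.
      of_int (prod_list (map sign \<sigma>s)) *
      (\<Prod>k = 1..n. of_int (prod_list (map sign (map (\<lambda>\<rho>. \<rho> k) \<rho>s))) * (\<Prod>a = 1..l. h k a \<sigma>s (map (\<lambda>\<rho>. \<rho> k) \<rho>s))))"
    unfolding S_def by (subst prod_sum_nlists) (simp_all add: finite_permutations sum_distrib_left)
  also have "\<dots> = (\<Sum>zs\<in>nlists (m - 1) (block_perms l n \<times> S).
      of_int (prod_list (map sign (map fst zs))) *
      (\<Prod>k = 1..n. of_int (prod_list (map sign (map (\<lambda>\<rho>. \<rho> k) (map snd zs)))) *
         (\<Prod>a = 1..l. h k a (map fst zs) (map (\<lambda>\<rho>. \<rho> k) (map snd zs)))))"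
    unfolding S_def by (rule sum_nlists_Times[OF finite_block_perms finite_PiE_permutes])
  also have "\<dots> = (\<Sum>zs\<in>nlists (m - 1) (block_perms l n \<times> S).
      of_int (prod_list (map sign (map (\<lambda>(\<sigma>, \<rho>). \<sigma> \<circ> glue_perms l n \<rho>) zs))) *
      (\<Prod>i = 1..l * n. H (map (\<lambda>\<pi>. \<pi> i) (map (\<lambda>(\<sigma>, \<rho>). \<sigma> \<circ> glue_perms l n \<rho>) zs) @ [word l n K i])))"
  proof (rule sum.cong[OF refl])
    fix zs assume "zs \<in> nlists (m - 1) (block_perms l n \<times> S)"
    then have zs: "set zs \<subseteq> block_perms l n \<times> S" by (rule nlistsE_set)
    have H: "h k a (map fst zs) (map (\<lambda>\<rho>. \<rho> k) (map snd zs)) =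
      H (map (\<lambda>\<pi>. \<pi> ((k - 1) * l + a)) (map (\<lambda>(\<sigma>, \<rho>). \<sigma> \<circ> glue_perms l n \<rho>) zs) @ [word l n K ((k - 1) * l + a)])"
      if k: "k \<in> {1..n}" and a: "a \<in> {1..l}" for k a
    proof -
      \<comment> \<open>Because \<open>\<sigma>\<close> increases on the interval, the element of
        rank \<open>\<rho> k a\<close> in its image is the value of \<open>\<sigma>\<close> at
        offset \<open>\<rho> k a\<close>.\<close>
      have "enum_set (\<sigma> ` interval l k) (\<rho> k a) = (\<sigma> \<circ> glue_perms l n \<rho>) ((k - 1) * l + a)"
        if "(\<sigma>, \<rho>) \<in> set zs" for \<sigma> \<rho>
      proof -
        have \<sigma>: "\<sigma> \<in> block_perms l n" and "\<rho> \<in> S" using that zs by auto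
        then have "\<rho> k permutes {1..l}" using k PiE_mem[of \<rho>] unfolding S_def by blast
        then have "\<rho> k a \<in> {1..l}" using a permutes_in_image by metis
        moreover have "k \<ge> 1" using k by simp
        ultimately show ?thesis
          using enum_set_image_interval[OF block_perms_strict_mono[OF \<sigma> k], of "\<rho> k a"]
            glue_perms_apply[OF k a, of \<rho>] by simp
      qed
      then have "map2 (\<lambda>J \<pi>. enum_set J (\<pi> a)) (map (\<lambda>\<sigma>. \<sigma> ` interval l k) (map fst zs)) (map (\<lambda>\<rho>. \<rho> k) (map snd zs))
        = map (\<lambda>\<pi>. \<pi> ((k - 1) * l + a)) (map (\<lambda>(\<sigma>, \<rho>). \<sigma> \<circ> glue_perms l n \<rho>) zs)"
        unfolding map_map map2_map_map by (intro map_cong refl) auto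
      then show ?thesis
        unfolding h_def word_apply[OF k a] by (simp only:)
    qed
    have "(\<Prod>k = 1..n. of_int (prod_list (map sign (map (\<lambda>\<rho>. \<rho> k) (map snd zs)))) *
         (\<Prod>a = 1..l. h k a (map fst zs) (map (\<lambda>\<rho>. \<rho> k) (map snd zs))))
      = of_int (\<Prod>k = 1..n. prod_list (map sign (map (\<lambda>\<rho>. \<rho> k) (map snd zs)))) *
        (\<Prod>i = 1..l * n. H (map (\<lambda>\<pi>. \<pi> i) (map (\<lambda>(\<sigma>, \<rho>). \<sigma> \<circ> glue_perms l n \<rho>) zs) @ [word l n K i]))"
      unfolding prod_blocks prod.distrib of_int_prod
      by (intro arg_cong2[where f = "(*)"] prod.cong refl H)
    then show "of_int (prod_list (map sign (map fst zs))) *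
      (\<Prod>k = 1..n. of_int (prod_list (map sign (map (\<lambda>\<rho>. \<rho> k) (map snd zs)))) *
         (\<Prod>a = 1..l. h k a (map fst zs) (map (\<lambda>\<rho>. \<rho> k) (map snd zs))))
      = of_int (prod_list (map sign (map (\<lambda>(\<sigma>, \<rho>). \<sigma> \<circ> glue_perms l n \<rho>) zs))) *
      (\<Prod>i = 1..l * n. H (map (\<lambda>\<pi>. \<pi> i) (map (\<lambda>(\<sigma>, \<rho>). \<sigma> \<circ> glue_perms l n \<rho>) zs) @ [word l n K i]))"
      using prod_list_sign_block_decomposition[OF zs[unfolded S_def]]
      by (simp only: of_int_mult mult.assoc)
  qed
  also have "\<dots> = alternating_sum (m - 1) (l * n) H (word l n K)"
    unfolding alternating_sum_def S_def
    by (rule sum_nlists_reindex[OF bij_betw_block_decomposition, symmetric])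
       (intro finite_cartesian_product finite_block_perms finite_PiE_permutes)
  finally show ?thesis .
qed

text \<open>The increasing enumeration of \<open>{1..L}\<close> is the identity, so selecting all
  rows has no effect and only the column choice \<open>P\<close> is left as the word.\<close>

lemma hyperdet_full_rows:
  assumes "even m" "m > 0"
  shows "hyperdet m L (subtensor H (map sorted_list_of_set (replicate (m - 1) {1..L} @ [P])))
    = alternating_sum (m - 1) L H (enum_set P)"
proof -
  have "map2 (\<lambda>J \<pi>. enum_set J (\<pi> a)) (replicate (m - 1) {1..L}) \<pi>s = map (\<lambda>\<pi>. \<pi> a) \<pi>s"
    if \<pi>s: "\<pi>s \<in> nlists (m - 1) {\<pi>. \<pi> permutes {1..L}}" and a: "a \<in> {1..L}" for \<pi>s a
  proof -
    have "map2 (\<lambda>J \<pi>. enum_set J (\<pi> a)) (replicate (m - 1) {1..L}) \<pi>s = map (\<lambda>\<pi>. enum_set {1..L} (\<pi> a)) \<pi>s"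
      using nlistsE_length[OF \<pi>s] by (simp add: zip_replicate1 o_def)
    also have "\<dots> = map (\<lambda>\<pi>. \<pi> a) \<pi>s"
    proof (intro map_cong refl enum_set_Icc)
      fix \<pi> assume "\<pi> \<in> set \<pi>s"
      then have "\<pi> permutes {1..L}" using nlists_nthD[OF \<pi>s] by simp
      then show "\<pi> a \<in> {1..L}" using a permutes_in_image by metis
    qed
    finally show ?thesis .
  qed
  then show ?thesis
    unfolding hyperdet_subtensor[OF assms length_replicate] alternating_sum_def
    by (intro sum.cong refl arg_cong2[where f = "(*)"] prod.cong) (simp only:)
qed

section \<open>The minor summation formula\<close>

theorem theorem1:
  fixes l m n N r :: nat
    and H :: "nat \<Rightarrow> nat list \<Rightarrow> 'a::field_char_0"
    and A Q :: "nat set list \<Rightarrow> 'a"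
  assumes "l > 0" "m > 0" "n > 0" "N > 0" "r > 0"
    and "even l" and "even m" and "l * n \<le> N"
    and Q: "\<And>Is. Is \<in> nlists ((m - 1) * r) (nsets {1..l * n} l) \<Longrightarrow>
      Q Is = (\<Sum>Ks \<in> nlists r (nsets {1..N} l).
        A Ks * (\<Prod>s = 1..r.
          hyperdet m l (subtensor (H s)
            (map sorted_list_of_set (index_group (m - 1) s Is @ [Ks ! (s - 1)])))))"
  shows "(\<Sum>Ps \<in> nlists r (nsets {1..N} (l * n)).
        hyperpf l r n (subarray A Ps) * (\<Prod>s = 1..r.
          hyperdet m (l * n) (subtensor (H s)
            (map sorted_list_of_set (replicate (m - 1) {1..l * n} @ [Ps ! (s - 1)])))))
      = hyperpf l ((m - 1) * r) n Q"
proof -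
  define d where "d = m - 1"
  \<comment> \<open>Oddness of \<open>d\<close> makes \<open>T s\<close> alternating: words with
    repeated letters contribute nothing, and each \<open>\<tau>\<close> contributes
    \<open>sign \<tau>\<close>.\<close>
  have d: "odd d" using assms(2,7) by (simp add: d_def)
  define X where "X = nsets {1..N} l"
  define F where "F = {1..n} \<rightarrow>\<^sub>E X"
  define D where "D = {K \<in> F. disjoint_family_on K {1..n}}"
  define V where "V = nsets {1..N} (l * n)"
  define B where "B = block_perms l n"
  define T where "T s w = alternating_sum d (l * n) (H s) w" for s w
  define h where "h s J K = hyperdet m l (subtensor (H s) (map sorted_list_of_set (J @ [K])))" for s J K
  have fin: "finite X" "finite F" "finite D" "finite V" "finite B"
    unfolding F_def D_def V_def B_def X_def
    by (auto intro!: finite_PiE finite_imp_finite_nsets finite_block_perms)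
  have KF: "finite (K k) \<and> card (K k) = l" if "K \<in> F" "k \<in> {1..n}" for K k
    using PiE_mem[OF that[unfolded F_def]] by (simp add: X_def nsets_def)
  have laplace: "(\<Sum>\<sigma>s\<in>nlists d B. of_int (prod_list (map sign \<sigma>s)) *
      (\<Prod>k = 1..n. h s (map (\<lambda>\<sigma>. \<sigma> ` interval l k) \<sigma>s) (K k))) = T s (word l n K)"
    if "K \<in> F" for s K
    unfolding h_def B_def T_def d_def
    by (rule laplace_expansion[OF assms(7,2)]) (rule KF[OF that])

  have QB: "Q (map (\<lambda>\<sigma>. \<sigma> ` interval l k) \<sigma>s) = (\<Sum>Ks\<in>nlists r X.
      A Ks * (\<Prod>s = 1..r. h s (map (\<lambda>\<sigma>. \<sigma> ` interval l k) (index_group d s \<sigma>s)) (Ks ! (s - 1))))"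
    if \<sigma>s: "\<sigma>s \<in> nlists (d * r) B" and k: "k \<in> {1..n}" for \<sigma>s k
  proof -
    \<comment> \<open>The formula for \<open>Q\<close> is available only at lists of
      \<open>l\<close>-subsets of \<open>{1..l * n}\<close>, so the interval images must be
      recognized as such.\<close>
    have "\<sigma> ` interval l k \<in> nsets {1..l * n} l" if "\<sigma> \<in> B" for \<sigma>
    proof -
      have "card (\<sigma> ` interval l k) = l"
        using card_image[OF permutes_inj_on[OF block_perms_permutes[OF that[unfolded B_def]]]]
          card_interval[of k l] k by simp
      then show ?thesis
        using block_perms_image_subset[OF that[unfolded B_def] k] finite_interval[of l k]
        by (simp add: nsets_def del: atLeastAtMost_iff)
    qed
    then have "map (\<lambda>\<sigma>. \<sigma> ` interval l k) \<sigma>s \<in> nlists ((m - 1) * r) (nsets {1..l * n} l)"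
      using nlistsE_length[OF \<sigma>s] nlistsE_set[OF \<sigma>s] unfolding d_def by (intro nlistsI) auto
    from Q[OF this] show ?thesis
      unfolding h_def X_def d_def index_group_map .
  qed

  have "hyperpf l ((m - 1) * r) n Q = 1 / fact n * (\<Sum>\<sigma>s\<in>nlists (d * r) B.
      of_int (prod_list (map sign \<sigma>s)) * (\<Prod>k = 1..n. \<Sum>Ks\<in>nlists r X.
        A Ks * (\<Prod>s = 1..r. h s (map (\<lambda>\<sigma>. \<sigma> ` interval l k) (index_group d s \<sigma>s)) (Ks ! (s - 1)))))"
    unfolding hyperpf_def d_def[symmetric] B_def[symmetric]
    by (intro arg_cong2[where f = "(*)"] sum.cong prod.cong refl QB)
  \<comment> \<open>Multiplying out over \<open>k\<close> yields one family
    \<open>\<kappa>s ! (s - 1)\<close> of \<open>n\<close> column sets for every \<open>s\<close>.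
    The products over \<open>k\<close> and \<open>s\<close> are exchanged and the total sign is
    distributed over the groups, so that each \<open>s\<close> carries its own factor.\<close>
  also have "(\<Sum>\<sigma>s\<in>nlists (d * r) B.
      of_int (prod_list (map sign \<sigma>s)) * (\<Prod>k = 1..n. \<Sum>Ks\<in>nlists r X.
        A Ks * (\<Prod>s = 1..r. h s (map (\<lambda>\<sigma>. \<sigma> ` interval l k) (index_group d s \<sigma>s)) (Ks ! (s - 1)))))
    = (\<Sum>\<sigma>s\<in>nlists (d * r) B. \<Sum>\<kappa>s\<in>nlists r F. (\<Prod>k = 1..n. A (map (\<lambda>\<kappa>. \<kappa> k) \<kappa>s)) *
        (\<Prod>s = 1..r. of_int (prod_list (map sign (index_group d s \<sigma>s))) *
          (\<Prod>k = 1..n. h s (map (\<lambda>\<sigma>. \<sigma> ` interval l k) (index_group d s \<sigma>s)) ((\<kappa>s ! (s - 1)) k))))"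
  proof (rule sum.cong[OF refl])
    fix \<sigma>s assume \<sigma>s: "\<sigma>s \<in> nlists (d * r) B"
    have sgn: "prod_list (map sign \<sigma>s) = (\<Prod>s = 1..r. prod_list (map sign (index_group d s \<sigma>s)))"
      by (rule prod_list_index_group[OF nlistsE_length[OF \<sigma>s]])
    have "of_int (prod_list (map sign \<sigma>s)) * (\<Prod>k = 1..n. \<Sum>Ks\<in>nlists r X.
        A Ks * (\<Prod>s = 1..r. h s (map (\<lambda>\<sigma>. \<sigma> ` interval l k) (index_group d s \<sigma>s)) (Ks ! (s - 1))))
      = (\<Sum>\<kappa>s\<in>nlists r F. of_int (prod_list (map sign \<sigma>s)) * (\<Prod>k = 1..n. A (map (\<lambda>\<kappa>. \<kappa> k) \<kappa>s) *
          (\<Prod>s = 1..r. h s (map (\<lambda>\<sigma>. \<sigma> ` interval l k) (index_group d s \<sigma>s)) (map (\<lambda>\<kappa>. \<kappa> k) \<kappa>s ! (s - 1)))))"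
      unfolding F_def prod_sum_nlists[OF finite_atLeastAtMost fin(1)] sum_distrib_left ..
    also have "\<dots> = (\<Sum>\<kappa>s\<in>nlists r F. (\<Prod>k = 1..n. A (map (\<lambda>\<kappa>. \<kappa> k) \<kappa>s)) *
        (\<Prod>s = 1..r. of_int (prod_list (map sign (index_group d s \<sigma>s))) *
          (\<Prod>k = 1..n. h s (map (\<lambda>\<sigma>. \<sigma> ` interval l k) (index_group d s \<sigma>s)) ((\<kappa>s ! (s - 1)) k))))"
    proof (rule sum.cong[OF refl])
      fix \<kappa>s assume \<kappa>s: "\<kappa>s \<in> nlists r F"
      have nth: "map (\<lambda>\<kappa>. \<kappa> k) \<kappa>s ! (s - 1) = (\<kappa>s ! (s - 1)) k" if "s \<in> {1..r}" for s k
        using that nlistsE_length[OF \<kappa>s] by (intro nth_map) auto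
      have "(\<Prod>k = 1..n. \<Prod>s = 1..r. h s (map (\<lambda>\<sigma>. \<sigma> ` interval l k) (index_group d s \<sigma>s)) (map (\<lambda>\<kappa>. \<kappa> k) \<kappa>s ! (s - 1)))
        = (\<Prod>s = 1..r. \<Prod>k = 1..n. h s (map (\<lambda>\<sigma>. \<sigma> ` interval l k) (index_group d s \<sigma>s)) (map (\<lambda>\<kappa>. \<kappa> k) \<kappa>s ! (s - 1)))"
        by (rule prod.swap)
      also have "\<dots> = (\<Prod>s = 1..r. \<Prod>k = 1..n. h s (map (\<lambda>\<sigma>. \<sigma> ` interval l k) (index_group d s \<sigma>s)) ((\<kappa>s ! (s - 1)) k))"
        by (intro prod.cong refl) (simp only: nth)
      finally show "of_int (prod_list (map sign \<sigma>s)) * (\<Prod>k = 1..n. A (map (\<lambda>\<kappa>. \<kappa> k) \<kappa>s) *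
          (\<Prod>s = 1..r. h s (map (\<lambda>\<sigma>. \<sigma> ` interval l k) (index_group d s \<sigma>s)) (map (\<lambda>\<kappa>. \<kappa> k) \<kappa>s ! (s - 1))))
        = (\<Prod>k = 1..n. A (map (\<lambda>\<kappa>. \<kappa> k) \<kappa>s)) *
        (\<Prod>s = 1..r. of_int (prod_list (map sign (index_group d s \<sigma>s))) *
          (\<Prod>k = 1..n. h s (map (\<lambda>\<sigma>. \<sigma> ` interval l k) (index_group d s \<sigma>s)) ((\<kappa>s ! (s - 1)) k)))"
        by (simp only: sgn of_int_prod prod.distrib mult_ac)
    qed
    finally show "of_int (prod_list (map sign \<sigma>s)) * (\<Prod>k = 1..n. \<Sum>Ks\<in>nlists r X.
        A Ks * (\<Prod>s = 1..r. h s (map (\<lambda>\<sigma>. \<sigma> ` interval l k) (index_group d s \<sigma>s)) (Ks ! (s - 1))))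
      = (\<Sum>\<kappa>s\<in>nlists r F. (\<Prod>k = 1..n. A (map (\<lambda>\<kappa>. \<kappa> k) \<kappa>s)) *
        (\<Prod>s = 1..r. of_int (prod_list (map sign (index_group d s \<sigma>s))) *
          (\<Prod>k = 1..n. h s (map (\<lambda>\<sigma>. \<sigma> ` interval l k) (index_group d s \<sigma>s)) ((\<kappa>s ! (s - 1)) k))))" .
  qed
  also have "\<dots> = (\<Sum>\<kappa>s\<in>nlists r F. \<Sum>\<sigma>s\<in>nlists (d * r) B. (\<Prod>k = 1..n. A (map (\<lambda>\<kappa>. \<kappa> k) \<kappa>s)) *
        (\<Prod>s = 1..r. of_int (prod_list (map sign (index_group d s \<sigma>s))) *
          (\<Prod>k = 1..n. h s (map (\<lambda>\<sigma>. \<sigma> ` interval l k) (index_group d s \<sigma>s)) ((\<kappa>s ! (s - 1)) k))))"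
    by (rule sum.swap)
  \<comment> \<open>For fixed column families the sum over the \<open>\<sigma>\<close>s factors over
    \<open>s\<close>, and each factor is one Laplace expansion.\<close>
  also have "\<dots> = (\<Sum>\<kappa>s\<in>nlists r F. (\<Prod>k = 1..n. A (map (\<lambda>\<kappa>. \<kappa> k) \<kappa>s)) *
        (\<Prod>s = 1..r. T s (word l n (\<kappa>s ! (s - 1)))))"
  proof (rule sum.cong[OF refl])
    fix \<kappa>s assume \<kappa>s: "\<kappa>s \<in> nlists r F"
    have "(\<Sum>\<sigma>s\<in>nlists (d * r) B. \<Prod>s = 1..r. of_int (prod_list (map sign (index_group d s \<sigma>s))) *
          (\<Prod>k = 1..n. h s (map (\<lambda>\<sigma>. \<sigma> ` interval l k) (index_group d s \<sigma>s)) ((\<kappa>s ! (s - 1)) k)))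
      = (\<Prod>s = 1..r. \<Sum>\<sigma>s\<in>nlists d B. of_int (prod_list (map sign \<sigma>s)) *
          (\<Prod>k = 1..n. h s (map (\<lambda>\<sigma>. \<sigma> ` interval l k) \<sigma>s) ((\<kappa>s ! (s - 1)) k)))"
      by (rule sum_nlists_index_group[OF fin(5), where f = "\<lambda>s \<sigma>s. of_int (prod_list (map sign \<sigma>s)) *
          (\<Prod>k = 1..n. h s (map (\<lambda>\<sigma>. \<sigma> ` interval l k) \<sigma>s) ((\<kappa>s ! (s - 1)) k))"])
    also have "\<dots> = (\<Prod>s = 1..r. T s (word l n (\<kappa>s ! (s - 1))))"
      by (intro prod.cong refl laplace nlistsE_nth_in[OF \<kappa>s]) auto
    finally show "(\<Sum>\<sigma>s\<in>nlists (d * r) B. (\<Prod>k = 1..n. A (map (\<lambda>\<kappa>. \<kappa> k) \<kappa>s)) *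
        (\<Prod>s = 1..r. of_int (prod_list (map sign (index_group d s \<sigma>s))) *
          (\<Prod>k = 1..n. h s (map (\<lambda>\<sigma>. \<sigma> ` interval l k) (index_group d s \<sigma>s)) ((\<kappa>s ! (s - 1)) k))))
      = (\<Prod>k = 1..n. A (map (\<lambda>\<kappa>. \<kappa> k) \<kappa>s)) * (\<Prod>s = 1..r. T s (word l n (\<kappa>s ! (s - 1))))"
      by (simp only: sum_distrib_left[symmetric])
  qed
  \<comment> \<open>If some family in the list is not disjoint, its word repeats a letter and the
    corresponding \<open>T s\<close> vanishes.\<close>
  also have "\<dots> = (\<Sum>\<kappa>s\<in>nlists r D. (\<Prod>k = 1..n. A (map (\<lambda>\<kappa>. \<kappa> k) \<kappa>s)) *
        (\<Prod>s = 1..r. T s (word l n (\<kappa>s ! (s - 1)))))"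
  proof (rule sum.mono_neutral_right)
    show "finite (nlists r F)" using fin(2) by (rule finite_nlists)
    show "nlists r D \<subseteq> nlists r F" unfolding D_def by (intro nlists_mono) blast
    show "\<forall>\<kappa>s\<in>nlists r F - nlists r D. (\<Prod>k = 1..n. A (map (\<lambda>\<kappa>. \<kappa> k) \<kappa>s)) *
        (\<Prod>s = 1..r. T s (word l n (\<kappa>s ! (s - 1)))) = 0"
    proof
      fix \<kappa>s assume \<kappa>s: "\<kappa>s \<in> nlists r F - nlists r D"
      then have len: "length \<kappa>s = r" and sub: "set \<kappa>s \<subseteq> F" using nlistsE_length[of \<kappa>s r F] nlistsE_set[of \<kappa>s r F] by blast+
      then have "\<not> set \<kappa>s \<subseteq> D" using \<kappa>s nlistsI by blast
      then obtain K where K: "K \<in> set \<kappa>s" "K \<notin> D" by blast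
      then obtain j where j: "j < r" "\<kappa>s ! j = K" using len by (auto simp: in_set_conv_nth)
      have "K \<in> F" using K sub by blast
      then have "\<not> inj_on (word l n K) {1..l * n}"
        using K(2) word_inj_on_iff[of n K l] KF unfolding D_def by blast
      then have "T (j + 1) (word l n K) = 0" unfolding T_def by (rule alternating_sum_eq_0[OF d])
      then have "\<exists>s\<in>{1..r}. T s (word l n (\<kappa>s ! (s - 1))) = 0"
        using j by (intro bexI[of _ "j + 1"]) simp_all
      then show "(\<Prod>k = 1..n. A (map (\<lambda>\<kappa>. \<kappa> k) \<kappa>s)) *
        (\<Prod>s = 1..r. T s (word l n (\<kappa>s ! (s - 1)))) = 0" by (simp add: prod_zero)
    qed
  qed
  \<comment> \<open>Every disjoint family is encoded by its union \<open>P\<close> and the pattern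
    \<open>\<tau>\<close> in which \<open>P\<close> is cut.\<close>
  also have "\<dots> = (\<Sum>zs\<in>nlists r (V \<times> B). (\<Prod>k = 1..n. A (map (\<lambda>\<kappa>. \<kappa> k) (map (block_family l n) zs))) *
        (\<Prod>s = 1..r. T s (word l n (map (block_family l n) zs ! (s - 1)))))"
    unfolding V_def B_def D_def F_def X_def
    by (rule sum_nlists_reindex[OF bij_betw_block_family])
       (intro finite_cartesian_product finite_imp_finite_nsets finite_block_perms finite_atLeastAtMost)
  also have "\<dots> = (\<Sum>zs\<in>nlists r (V \<times> B). (\<Prod>k = 1..n. subarray A (map fst zs) (map (\<lambda>\<tau>. \<tau> ` interval l k) (map snd zs))) *
        (of_int (prod_list (map sign (map snd zs))) * (\<Prod>s = 1..r. T s (enum_set (map fst zs ! (s - 1))))))"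
  proof (rule sum.cong[OF refl])
    fix zs assume zs: "zs \<in> nlists r (V \<times> B)"
    then have len: "length zs = r" by (rule nlistsE_length)
    have 1: "A (map (\<lambda>\<kappa>. \<kappa> k) (map (block_family l n) zs))
      = subarray A (map fst zs) (map (\<lambda>\<tau>. \<tau> ` interval l k) (map snd zs))" if "k \<in> {1..n}" for k
      unfolding subarray_def map_map map2_map_map
      using that by (intro arg_cong[where f = A] map_cong refl) (simp add: block_family_def case_prod_unfold)
    \<comment> \<open>The word is the enumeration of \<open>P\<close> with positions permuted by
      \<open>\<tau>\<close>, so \<open>T s\<close> gains \<open>sign \<tau> ^ d\<close>, which is
      \<open>sign \<tau>\<close> for odd \<open>d\<close>. These are the signs that the
      hyperpfaffian of the subarray requires.\<close>
    have 2: "T s (word l n (map (block_family l n) zs ! (s - 1)))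
      = of_int (sign (map snd zs ! (s - 1))) * T s (enum_set (map fst zs ! (s - 1)))" if "s \<in> {1..r}" for s
    proof -
      have s: "s - 1 < r" using that by auto
      obtain P \<tau> where z: "zs ! (s - 1) = (P, \<tau>)" by (cases "zs ! (s - 1)")
      then have P: "P \<in> V" and \<tau>: "\<tau> \<in> B" using nlistsE_nth_in[OF zs s] by auto
      have \<tau>p: "\<tau> permutes {1..l * n}" using block_perms_permutes \<tau> unfolding B_def .
      have sgn: "sign \<tau> ^ d = sign \<tau>" using d by (cases \<tau> rule: sign_cases) simp_all
      have "T s (word l n (block_family l n (P, \<tau>))) = T s (enum_set P \<circ> \<tau>)"
        unfolding T_def
        using word_block_family[OF P[unfolded V_def] \<tau>[unfolded B_def]]
        by (intro alternating_sum_cong) simp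
      also have "\<dots> = of_int (sign \<tau>) * T s (enum_set P)"
        unfolding T_def alternating_sum_comp[OF \<tau>p] sgn ..
      finally show ?thesis using s len z by simp
    qed
    have "(\<Prod>s = 1..r. of_int (sign (map snd zs ! (s - 1)))) = (of_int (prod_list (map sign (map snd zs))) :: 'a)"
    proof -
      have "(\<Prod>s = 1..r. sign (map snd zs ! (s - 1))) = (\<Prod>i<r. sign (map snd zs ! i))"
        by (rule prod.reindex_bij_witness[where i = "\<lambda>i. i + 1" and j = "\<lambda>s. s - 1"]) auto
      also have "\<dots> = prod_list (map sign (map snd zs))"
        unfolding prod.list_conv_set_nth using len by (simp add: atLeast0LessThan)
      finally show ?thesis unfolding of_int_prod[symmetric] by (simp only:)
    qed
    then show "(\<Prod>k = 1..n. A (map (\<lambda>\<kappa>. \<kappa> k) (map (block_family l n) zs))) *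
        (\<Prod>s = 1..r. T s (word l n (map (block_family l n) zs ! (s - 1))))
      = (\<Prod>k = 1..n. subarray A (map fst zs) (map (\<lambda>\<tau>. \<tau> ` interval l k) (map snd zs))) *
        (of_int (prod_list (map sign (map snd zs))) * (\<Prod>s = 1..r. T s (enum_set (map fst zs ! (s - 1)))))"
      by (simp only: 1 2 prod.distrib cong: prod.cong)
  qed
  also have "\<dots> = (\<Sum>Ps\<in>nlists r V. \<Sum>\<tau>s\<in>nlists r B. (\<Prod>k = 1..n. subarray A Ps (map (\<lambda>\<tau>. \<tau> ` interval l k) \<tau>s)) *
        (of_int (prod_list (map sign \<tau>s)) * (\<Prod>s = 1..r. T s (enum_set (Ps ! (s - 1))))))"
    by (rule sum_nlists_Times[OF fin(4,5), symmetric])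
  finally have "hyperpf l ((m - 1) * r) n Q = 1 / fact n *
      (\<Sum>Ps\<in>nlists r V. \<Sum>\<tau>s\<in>nlists r B. (\<Prod>k = 1..n. subarray A Ps (map (\<lambda>\<tau>. \<tau> ` interval l k) \<tau>s)) *
        (of_int (prod_list (map sign \<tau>s)) * (\<Prod>s = 1..r. T s (enum_set (Ps ! (s - 1))))))" .
  \<comment> \<open>The factors \<open>T s\<close> depend on \<open>Ps\<close> alone; what remains
    of the inner sum over the \<open>\<tau>\<close>s, together with \<open>1 / fact n\<close>, is
    the hyperpfaffian of the subarray.\<close>
  also have "\<dots> = (\<Sum>Ps\<in>nlists r V. hyperpf l r n (subarray A Ps) * (\<Prod>s = 1..r. T s (enum_set (Ps ! (s - 1)))))"
    unfolding hyperpf_def B_def[symmetric] by (simp only: sum_distrib_left sum_distrib_right mult_ac)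
  also have "\<dots> = (\<Sum>Ps \<in> nlists r (nsets {1..N} (l * n)).
        hyperpf l r n (subarray A Ps) * (\<Prod>s = 1..r.
          hyperdet m (l * n) (subtensor (H s)
            (map sorted_list_of_set (replicate (m - 1) {1..l * n} @ [Ps ! (s - 1)])))))"
    unfolding hyperdet_full_rows[OF assms(7,2)] V_def T_def d_def ..
  finally show ?thesis by (rule sym)
qed

end
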